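(* Let $k\in\mathbb N$ with $k\equiv 0\pmod 4$, let $h\in\mathbb Z$ with $\gcd(h,k)=1$, and let $q=\zeta_k^h$. Let $b$ be a (nonzero complex) parameter and put $$p_{h,k}(b,q) := \left(1+(-b^{-1})^{k/2}(1-b^{k/2})\right)\,b^{\frac{k}{2}-1}\,\left(1+(-1)^h(1-b^{-k/2})\right).$$ Then, for either choice of the sign $\pm$ (the same choice throughout), $$\sum_{n=0}^{k-1}(b;q^2)_n(-b^{-1}q^2)^n = p_{h,k}(b,q)\,(-1)^h\,(\pm b)\,\bigl(1-b^{-k/2}-(-1)^h\bigr)\left(\sum_{n=0}^\infty \frac{q^{n^2+n}}{(\pm b^{-1}q^2;q^2)_{n+1}}-\left(\sum_{\ell=0}^\infty q^{\ell^2+\ell}\right)\prod_{m=0}^\infty\frac{1}{1-b^{-2}q^{4m+4}}\right),$$ for all values of $b$ for which the two sides simultaneously converge, in the sense described in the context.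
   Context: Notation: $\zeta_N:=e^{2\pi i/N}$ for $N\in\mathbb N$; $(a;q)_n:=\prod_{j=0}^{n-1}(1-aq^j)$ for $n\in\mathbb N_0\cup\{\infty\}$. Convention on parameters: identities are stated without enforced conditions on the parameter $b$; they are understood to hold for any values of $b$ such that the left- and right-hand sides simultaneously converge, or in appropriate limiting situations. Here the series $\sum_{n\ge 0} q^{n^2+n}/(\pm b^{-1}q^2;q^2)_{n+1}$ is evaluated directly at $q=\zeta_k^h$ (and must converge there, in particular have nonzero denominators), while the product $\left(\sum_{\ell\ge 0} q^{\ell^2+\ell}\right)\prod_{m\ge 0}(1-b^{-2}q^{4m+4})^{-1}$, whose factors are defined by power series and infinite products in $|q|<1$, is understood at $q=\zeta_k^h$ as its radial limit $\lim_{r\to1^-}$ along $q=r\zeta_k^h$ from inside the unit disk (and this limit must exist). *)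

theory Defs
  imports "HOL-Analysis.Analysis"
begin

definition zeta :: "nat \<Rightarrow> complex" where
  "zeta N = exp (2 * of_real pi * \<i> / of_nat N)"

definition qpoch :: "complex \<Rightarrow> complex \<Rightarrow> nat \<Rightarrow> complex" where
  "qpoch a q n = (\<Prod>j<n. 1 - a * q ^ j)"

(* Only used for k divisible by 4, where k div 2 is the exact half and k div 2 - 1 does not
   truncate. The polynomial depends on q only through h and k. *)
definition p_factor :: "int \<Rightarrow> nat \<Rightarrow> complex \<Rightarrow> complex" where
  "p_factor h k b =
     (1 + (- inverse b) ^ (k div 2) * (1 - b ^ (k div 2)))
     * b ^ (k div 2 - 1)
     * (1 + (-1) powi h * (1 - b powi (- int (k div 2))))"

definition series_denom :: "complex \<Rightarrow> complex \<Rightarrow> complex \<Rightarrow> nat \<Rightarrow> complex" where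
  "series_denom s b q n = qpoch (s * inverse b * q\<^sup>2) (q\<^sup>2) (n + 1)"

(* Meant for norm q < 1. If b^2 = q^(4m+4) for some m, the function has a pole at q, whereas here
   the convention 1/0 = 0 gives the value 0. This does not affect limits at the unit circle: when
   such points accumulate along a radius, the function is unbounded there and has no limit. *)
definition theta_product :: "complex \<Rightarrow> complex \<Rightarrow> complex" where
  "theta_product b q =
     (\<Sum>l. q ^ (l\<^sup>2 + l)) * (\<Prod>m. 1 / (1 - b powi (-2) * q ^ (4 * m + 4)))"

end

theory Submission
  imports Defs "HOL-Complex_Analysis.Complex_Analysis" "HOL-Real_Asymp.Real_Asymp"
begin

text \<open>Put \<open>M = k/2\<close>, \<open>Q = q\<^sup>2\<close>, \<open>z = \<plusminus>1/b\<close> and \<open>c = z\<^sup>M\<close>. Since \<open>h\<close> is odd, \<open>p = c/b\<close>. The terms of the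
  series satisfy \<open>a\<^sub>n\<^sub>+\<^sub>M = - a\<^sub>n / (1 - c)\<close>, so convergence forces \<open>\<bar>1 - c\<bar> > 1\<close> and reduces the series to
  its first \<open>M\<close> terms. The radial limit \<open>L\<close> is \<open>0\<close>: Gauss's product for the triangular theta series turns
  the function into a quotient of \<open>q\<close>-Pochhammer products, and Riemann sums give its logarithm as
  \<open>-(\<pi>\<^sup>2/4 - Re Li\<^sub>2(c)) / (M/2)\<close> times a large parameter, where \<open>Re Li\<^sub>2(c) < \<pi>\<^sup>2/4\<close> for \<open>\<bar>1 - c\<bar> \<ge> 1\<close>.
  For real \<open>c > 2\<close> this breaks down, but then poles accumulate on the radius and there is no limit.
  What remains is an identity between two finite sums, which satisfy the same first-order
  \<open>Q\<close>-difference equation.\<close>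

subsection \<open>The finite identity at a root of unity\<close>

text \<open>The constant pi^2/4 is pi^2/6 + pi^2/12. With N = k/4, the Euler product (q^4; q^4)
  brings in Li_2(1) = pi^2/6, and the denominator (q^2; q^4) brings in Li_2(-1) = -pi^2/12, because
  (q^2)^N = -1. The same constant is the supremum of Re Li_2(c) over |1 - c| >= 1, approached as c
  tends to 2. So the condition under which the series converges is what makes the radial limit
  vanish, and the constants leave no slack.

  A limit 0 can be read off from moduli. Hence only real parts of dilogarithms occur, and no branch
  of the logarithm of a product has to be followed.

  Two obstacles shape the analysis. The point c may lie outside the unit disk, out of reach of the
  power series, so the dilogarithm is continued to the plane slit along [1, oo). The Euler product
  needs the value at the branch point 1, and there one-sided estimates must do; they point in the
  direction that bounds the quotient from above.\<close>

lemma prod_one_minus_roots: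
  fixes w z :: complex
  assumes inj: "inj_on (\<lambda>j. w ^ j) {..<n}" and w: "w ^ n = 1" and n: "n > 0"
  shows "(\<Prod>j<n. 1 - z * w ^ j) = 1 - z ^ n"
proof -
  define p where "p = (\<Prod>j<n. [:1, - (w ^ j):]) - ([:1:] - monom 1 n)"
  have w0: "w \<noteq> 0" using w n by (metis power_0_left zero_neq_one not_gr0)
  have pz: "poly p x = (\<Prod>j<n. 1 - x * w ^ j) - (1 - x ^ n)" for x
    by (simp add: p_def poly_prod poly_monom)
  have "degree (\<Prod>j<n. [:1, - (w ^ j):]) \<le> (\<Sum>j<n. degree [:1, - (w ^ j):])"
    using degree_prod_sum_le[of "{..<n}" "\<lambda>j. [:1, - (w ^ j):]"] by (simp add: comp_def)
  also have "\<dots> \<le> (\<Sum>j<n. 1)" by (intro sum_mono) simp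
  finally have "degree (\<Prod>j<n. [:1, - (w ^ j):]) \<le> n" by simp
  then have deg: "degree p \<le> n"
    unfolding p_def by (intro degree_diff_le) (auto simp: degree_monom_le)
  have "p = 0"
  proof (rule ccontr)
    assume p: "p \<noteq> 0"
    \<comment> \<open>The test points are 0 and the n distinct inverse powers: one more than the
      degree allows. Having 0 among them replaces a comparison of leading coefficients.\<close>
    define R where "R = insert 0 ((\<lambda>j. inverse (w ^ j)) ` {..<n})"
    have inj': "inj_on (\<lambda>j. inverse (w ^ j)) {..<n}"
      using inj by (auto simp: inj_on_def)
    have "card R = Suc n"
      unfolding R_def using w0 inj' by (subst card_insert_disjoint) (auto simp: card_image)
    moreover have "R \<subseteq> {x. poly p x = 0}"
    proof
      fix x assume "x \<in> R"
      then consider "x = 0" | j where "j < n" "x = inverse (w ^ j)" by (auto simp: R_def)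
      then show "x \<in> {x. poly p x = 0}"
      proof cases
        case 1 then show ?thesis using n by (simp add: pz)
      next
        case 2
        have "(w ^ j) ^ n = 1" using w by (metis power_mult mult.commute power_one)
        then have "x ^ n = 1" using 2 by (simp add: power_inverse)
        moreover have "(\<Prod>j<n. 1 - x * w ^ j) = 0"
          using 2 w0 by (intro prod_zero) (auto intro!: bexI[of _ j])
        ultimately show ?thesis by (simp add: pz)
      qed
    qed
    ultimately have "Suc n \<le> card {x. poly p x = 0}"
      using card_mono[OF poly_roots_finite[OF p]] by metis
    also have "\<dots> \<le> degree p" using p by (rule card_poly_roots_bound)
    finally show False using deg by simp
  qed
  then show ?thesis using pz[of z] by simp
qed

lemma qpoch_Suc: "qpoch a q (Suc n) = qpoch a q n * (1 - a * q ^ n)"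
  by (simp add: qpoch_def)

lemma qpoch_Suc_left: "qpoch a q (Suc n) = (1 - a) * qpoch (a * q) q n"
  by (simp add: qpoch_def prod.lessThan_Suc_shift mult.assoc del: prod.lessThan_Suc)

lemma qpoch_add: "qpoch a q (m + n) = qpoch a q m * qpoch (a * q ^ m) q n"
  by (induction n) (auto simp: qpoch_Suc qpoch_def power_add mult.assoc)

lemma qpoch_nonzero:
  assumes "\<And>j. a * q ^ j \<noteq> 1"
  shows "qpoch a q n \<noteq> 0"
proof -
  have "1 - a * q ^ j \<noteq> 0" for j using assms[of j] by (metis eq_iff_diff_eq_0)
  then show ?thesis by (simp only: qpoch_def prod_zero_iff finite_lessThan) blast
qed

text \<open>Here q is a primitive root of unity of order 2M and Q one of order M; injectivity of the
  powers is the form in which primitivity is used. M is even because 4 divides k.\<close>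

locale root_of_unity =
  fixes M :: nat and q Q :: complex
  assumes M: "even M" "M > 0"
    and Q: "Q = q\<^sup>2"
    and qM: "q ^ M = -1"
    and inj: "inj_on (\<lambda>j. Q ^ j) {..<M}"
begin

lemma QM: "Q ^ M = 1"
  using qM by (simp add: Q power2_eq_square power_mult_distrib)

lemma q_nonzero: "q \<noteq> 0" using qM M by (metis power_0_left neg_equal_0_iff_equal one_neq_zero not_gr0)

lemma Q_nonzero: "Q \<noteq> 0" using q_nonzero by (simp add: Q)

lemma qpoch_M: "qpoch a Q M = 1 - a ^ M"
  unfolding qpoch_def using prod_one_minus_roots[OF inj QM] M by simp

lemma Q_pow_M: "(z * Q ^ j) ^ M = z ^ M"
  using QM by (simp add: power_mult_distrib flip: power_mult) (simp add: power_mult mult.commute[of j])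

lemma qpoch_root_nonzero:
  assumes "z ^ M \<noteq> 1" shows "qpoch z Q n \<noteq> 0"
  using Q_pow_M[of z] assms by (intro qpoch_nonzero) (metis power_one)

text \<open>The exponent grows by M times 2n + M + 1, which is odd since M is even, and q^M =
  -1.\<close>

lemma q_quad: "q ^ ((n + M)\<^sup>2 + (n + M)) = - (q ^ (n\<^sup>2 + n))"
proof -
  have "(n + M)\<^sup>2 + (n + M) = (n\<^sup>2 + n) + M * (2 * n + (M + 1))"
    by (simp add: power2_eq_square algebra_simps)
  moreover have "q ^ (M * (2 * n + (M + 1))) = -1"
    unfolding power_mult qM using M by simp
  ultimately show ?thesis by (simp only: power_add) simp
qed

definition half_theta :: "complex \<Rightarrow> complex" where
  "half_theta z = (\<Sum>n<M. q ^ (n\<^sup>2 + n) / qpoch (z * Q) Q (Suc n))"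

text \<open>With \<beta> = 1/b these are the first M terms of the left-hand sum, since (1 - b
  Q^j)(-Q/b) = Q (Q^j - 1/b). Written this way they are polynomials in \<beta>, ready for the shift
  \<beta> -> \<beta> Q.\<close>

definition finite_side :: "complex \<Rightarrow> complex" where
  "finite_side \<beta> = (\<Sum>n<M. Q ^ n * (\<Prod>j<n. Q ^ j - \<beta>))"

text \<open>The shift moves every denominator up by one factor, and 1 = z Q^(n+2) + (1 - z Q^(n+2))
  splits the shifted term into neighbouring terms of the old sum. Summing both over a full period
  leaves only the boundary terms \<open>a 0\<close> and \<open>a M\<close>.\<close>

lemma half_theta_shift:
  assumes z: "z ^ M \<noteq> 1"
  shows "half_theta (z * Q) = (1 - z\<^sup>2 * Q\<^sup>2) * half_theta z - z * Q * (1 + 1 / (1 - z ^ M))"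
proof -
  define D where "D = qpoch (z * Q) Q"
  define a where "a = (\<lambda>n. q ^ (n\<^sup>2 + n) / D (Suc n))"
  have zM: "(z * Q) ^ M = z ^ M" using Q_pow_M[of z 1] by simp
  have D0: "D n \<noteq> 0" for n unfolding D_def by (rule qpoch_root_nonzero) (simp add: zM z)
  have zQ: "1 - z * Q \<noteq> 0" using D0[of 1] by (simp add: D_def qpoch_def)
  have step: "q ^ (n\<^sup>2 + n) / qpoch (z * Q * Q) Q (Suc n) = (1 - z * Q) * (z * Q * a (Suc n) + a n)" for n
  proof -
    have 1: "qpoch (z * Q * Q) Q (Suc n) = D (Suc (Suc n)) / (1 - z * Q)"
      using zQ by (simp add: D_def qpoch_Suc_left[of "z * Q" Q "Suc n"])
    have e: "(Suc n)\<^sup>2 + Suc n = n\<^sup>2 + n + 2 * Suc n"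
      by (simp add: power2_eq_square algebra_simps)
    have 2: "a (Suc n) = Q ^ Suc n * q ^ (n\<^sup>2 + n) / D (Suc (Suc n))"
      unfolding a_def e by (simp only: power_add power_mult Q) (simp add: mult_ac)
    have 3: "D (Suc (Suc n)) = D (Suc n) * (1 - z * Q * Q ^ Suc n)"
      by (simp only: D_def qpoch_Suc)
    have n0: "1 - z * Q * Q ^ Suc n \<noteq> 0" using D0[of "Suc (Suc n)"] 3 by auto
    show ?thesis
      unfolding 1 2 unfolding 3 a_def using n0 zQ D0[of "Suc n"] by (simp add: field_simps)
  qed
  have "half_theta (z * Q) = (\<Sum>n<M. (1 - z * Q) * (z * Q * a (Suc n) + a n))"
    unfolding half_theta_def by (intro sum.cong refl step)
  also have "\<dots> = (1 - z * Q) * (z * Q * (\<Sum>n<M. a (Suc n)) + (\<Sum>n<M. a n))"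
    by (simp add: sum_distrib_left[symmetric] sum.distrib)
  also have "(\<Sum>n<M. a (Suc n)) = (\<Sum>n<M. a n) + a M - a 0"
    by (metis add_diff_cancel_left' sum.lessThan_Suc sum.lessThan_Suc_shift)
  also have "(\<Sum>n<M. a n) = half_theta z" by (simp add: half_theta_def a_def D_def)
  also have "a 0 = 1 / (1 - z * Q)" by (simp add: a_def D_def qpoch_def)
  also have "a M = - 1 / ((1 - z ^ M) * (1 - z * Q))"
  proof -
    have "D (Suc M) = (1 - z ^ M) * (1 - z * Q)"
      by (simp add: D_def qpoch_Suc qpoch_M zM QM)
    moreover have "q ^ (M\<^sup>2 + M) = -1" using q_quad[of 0] by simp
    ultimately show ?thesis by (simp add: a_def)
  qed
  finally have eq: "half_theta (z * Q) = (1 - z * Q) *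
      (z * Q * (half_theta z + - 1 / ((1 - z ^ M) * (1 - z * Q)) - 1 / (1 - z * Q)) + half_theta z)" .
  have "(1 - z * Q) * (- 1 / ((1 - z ^ M) * (1 - z * Q)) - 1 / (1 - z * Q)) = - (1 + 1 / (1 - z ^ M))"
    using z zQ by (simp add: divide_simps)
  then show ?thesis unfolding eq by algebra
qed

text \<open>The auxiliary sum \<open>K\<close> drops the weights Q^n. Two relations tie it to
  \<open>finite_side\<close>: one at the same argument, by telescoping Q^n r_n = r_(n+1) + \<beta>
  r_n, and one across the shift, since r_(n+1)(\<beta> Q) = (1 - \<beta> Q) Q^n r_n(\<beta>).
  Eliminating \<open>K\<close> gives the equation.\<close>

lemma finite_side_shift:
  "finite_side (\<beta> * Q) = (1 - \<beta>\<^sup>2 * Q\<^sup>2) * finite_side \<beta> + \<beta> * Q * (2 - \<beta> ^ M)"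
proof -
  define r where "r = (\<lambda>\<beta> n. \<Prod>j<n. Q ^ j - \<beta>)"
  define K where "K = (\<lambda>\<beta>. \<Sum>n<M. r \<beta> n)"
  have fs: "finite_side \<beta> = (\<Sum>n<M. Q ^ n * r \<beta> n)" for \<beta> by (simp add: finite_side_def r_def)
  have rM: "r \<beta> M = \<beta> ^ M - 1" for \<beta>
  proof -
    \<comment> \<open>The exponent M(M-1)/2 on Q is M(M-1) on q, so the value is (-1)^(M-1) with M
      even.\<close>
    have Qhalf: "(\<Prod>j<M. Q ^ j) = -1"
    proof -
      obtain N where N: "M = 2 * N" using M by auto
      have "(\<Prod>j<M. Q ^ j) = Q ^ (\<Sum>j<M. j)" by (simp add: power_sum)
      also have "(\<Sum>j<M. j) = N * (M - 1)"
        using N by (simp add: lessThan_atLeast0 Sum_Ico_nat)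
      also have "Q ^ \<dots> = (q ^ M) ^ (M - 1)" by (simp add: Q N mult_ac flip: power_mult)
      also have "\<dots> = -1" using M by (simp add: qM)
      finally show ?thesis .
    qed
    have "r \<beta> M = (\<Prod>j<M. Q ^ j * (1 - \<beta> * inverse Q ^ j))"
      unfolding r_def using Q_nonzero by (intro prod.cong) (auto simp: field_simps)
    also have "\<dots> = - (\<Prod>j<M. 1 - \<beta> * inverse Q ^ j)" by (simp add: prod.distrib Qhalf)
    also have "(\<Prod>j<M. 1 - \<beta> * inverse Q ^ j) = 1 - \<beta> ^ M"
      using inj QM M by (intro prod_one_minus_roots) (auto simp: inj_on_def power_inverse)
    finally show ?thesis by simp
  qed
  have r0: "r \<beta> 0 = 1" and rS: "r \<beta> (Suc n) = r \<beta> n * (Q ^ n - \<beta>)" for \<beta> n by (auto simp: r_def)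
  have H: "finite_side \<beta> = (1 + \<beta>) * K \<beta> + r \<beta> M - 1" for \<beta>
  proof -
    have "finite_side \<beta> = (\<Sum>n<M. r \<beta> (Suc n) + \<beta> * r \<beta> n)"
      by (simp add: fs rS algebra_simps)
    also have "\<dots> = (\<Sum>n<M. r \<beta> (Suc n)) + \<beta> * K \<beta>" by (simp add: sum.distrib K_def sum_distrib_left)
    also have "(\<Sum>n<M. r \<beta> (Suc n)) = K \<beta> + r \<beta> M - 1"
      unfolding K_def by (metis add_diff_cancel_left' sum.lessThan_Suc sum.lessThan_Suc_shift r0)
    finally show ?thesis by (simp add: algebra_simps)
  qed
  have rQ: "r (\<beta> * Q) (Suc n) = (1 - \<beta> * Q) * (Q ^ n * r \<beta> n)" for n
  proof (induction n)
    case (Suc n)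
    have "r (\<beta> * Q) (Suc (Suc n)) = r (\<beta> * Q) (Suc n) * (Q ^ Suc n - \<beta> * Q)" by (rule rS)
    also have "\<dots> = (1 - \<beta> * Q) * (Q ^ Suc n * r \<beta> (Suc n))"
      unfolding Suc.IH rS[of \<beta>] by (simp add: algebra_simps)
    finally show ?case .
  qed (simp add: r_def)
  have "K (\<beta> * Q) + r (\<beta> * Q) M = 1 + (\<Sum>n<M. r (\<beta> * Q) (Suc n))"
    unfolding K_def by (metis sum.lessThan_Suc sum.lessThan_Suc_shift r0)
  also have "\<dots> = 1 + (1 - \<beta> * Q) * finite_side \<beta>"
    unfolding rQ fs by (simp add: sum_distrib_left)
  finally have K: "K (\<beta> * Q) = 1 + (1 - \<beta> * Q) * finite_side \<beta> - r (\<beta> * Q) M" by algebra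
  have bM: "(\<beta> * Q) ^ M = \<beta> ^ M" using Q_pow_M[of \<beta> 1] by simp
  show ?thesis unfolding H[of "\<beta> * Q"] K rM bM by (simp add: algebra_simps power2_eq_square)
qed

text \<open>Both sides satisfy \<open>X(zQ) = (1 - z\<^sup>2Q\<^sup>2) X(z) - zQ(2 - z\<^sup>M)\<close>. Going once around the
  \<open>M\<close>-th roots of unity multiplies their difference by \<open>(1 - z\<^sup>M)\<^sup>2\<close>.\<close>

lemma half_theta_eq_finite_side:
  assumes z: "z ^ M \<noteq> 1" "z ^ M \<noteq> 2" "z \<noteq> 0" and s: "s = 1 \<or> s = -1"
  shows "finite_side (s * z) = - s * (1 - z ^ M) * half_theta z"
proof -
  define \<Delta> where "\<Delta> = (\<lambda>z. (1 - z ^ M) * half_theta z + s * finite_side (s * z))"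
  have ss: "s * s = 1" "s ^ M = 1" using s M by auto
  have shift: "\<Delta> (z * Q) = (1 - z\<^sup>2 * Q\<^sup>2) * \<Delta> z" if "z ^ M \<noteq> 1" for z
  proof -
    have 1: "(z * Q) ^ M = z ^ M" using Q_pow_M[of z 1] by simp
    have 2: "finite_side (s * (z * Q)) = (1 - z\<^sup>2 * Q\<^sup>2) * finite_side (s * z) + s * z * Q * (2 - z ^ M)"
      using finite_side_shift[of "s * z"] ss
      by (simp add: mult.assoc power_mult_distrib power2_eq_square[of s])
    have "(1 - z ^ M) * (1 + 1 / (1 - z ^ M)) = 2 - z ^ M" using that by (simp add: divide_simps)
    moreover have "u * (v * A - y * w) = v * (u * A) - y * t" if "u * w = t" for u v w y t A :: complex
      using that[symmetric] by (simp add: algebra_simps)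
    ultimately have 3: "(1 - z ^ M) * half_theta (z * Q) = (1 - z\<^sup>2 * Q\<^sup>2) * ((1 - z ^ M) * half_theta z) - z * Q * (2 - z ^ M)"
      unfolding half_theta_shift[OF that] by blast
    have "(v * A - y * t) + s * (v * B + s * y * t) = v * (A + s * B)" for v A B y t
      using s by (elim disjE) (simp_all add: algebra_simps)
    then show ?thesis unfolding \<Delta>_def 1 2 3 by (simp add: mult.assoc)
  qed
  \<comment> \<open>The inhomogeneous terms cancel in \<Delta>, and 1 - z^2 Q^(2n+2) factors into a
    step for z and a step for -z. After M steps each product is 1 - z^M, the second one because M is
    even.\<close>
  have iter: "\<Delta> (z * Q ^ n) = qpoch (z * Q) Q n * qpoch (- z * Q) Q n * \<Delta> z" for n
  proof (induction n)
    case (Suc n)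
    have "\<Delta> (z * Q ^ Suc n) = \<Delta> (z * Q ^ n * Q)" by (simp add: mult_ac)
    also have "\<dots> = (1 - (z * Q ^ n)\<^sup>2 * Q\<^sup>2) * \<Delta> (z * Q ^ n)"
      using z by (intro shift) (simp add: Q_pow_M)
    also have "\<dots> = qpoch (z * Q) Q (Suc n) * qpoch (- z * Q) Q (Suc n) * \<Delta> z"
      unfolding Suc.IH qpoch_Suc by (simp add: power2_eq_square algebra_simps)
    finally show ?case .
  qed (simp add: qpoch_def)
  have "\<Delta> z = (1 - z ^ M) * (1 - z ^ M) * \<Delta> z"
    using iter[of M] Q_pow_M[of z 1] M by (simp add: qpoch_M QM)
  \<comment> \<open>(1 - t)^2 = 1 holds only for t = 0 and t = 2; this is where z = 0 and z^M = 2
    are excluded.\<close>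
  moreover have "t * (t - 2) * d = 0" if "d = (1 - t) * (1 - t) * d" for t d :: complex
    using that by (simp add: algebra_simps)
  ultimately have "z ^ M * (z ^ M - 2) * \<Delta> z = 0" by blast
  then have "\<Delta> z = 0" using z by simp
  then have "s * finite_side (s * z) = - ((1 - z ^ M) * half_theta z)"
    by (simp add: \<Delta>_def eq_neg_iff_add_eq_0 add.commute)
  then show ?thesis using s by (auto simp: algebra_simps)
qed

end

subsection \<open>Gauss's product for the triangular theta series\<close>

lemma power_ne_one:
  fixes x :: complex
  assumes "norm x < 1" "n > 0" shows "x ^ n \<noteq> 1"
proof
  assume "x ^ n = 1"
  then have "norm x ^ n = 1" by (metis norm_power norm_one)
  moreover have "norm x ^ n < 1" using assms by (simp add: power_less_one_iff)
  ultimately show False by simp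
qed

lemma convergent_prod_qpoch:
  fixes a q :: complex
  assumes q: "norm q < 1"
  shows "convergent_prod (\<lambda>j. 1 - a * q ^ j)"
proof -
  have "summable (\<lambda>j. norm a * norm q ^ j)"
    using q by (intro summable_mult summable_geometric) simp
  then have "summable (\<lambda>j. norm ((1 - a * q ^ j) - 1))"
    by (simp add: norm_mult norm_power)
  then show ?thesis
    by (intro abs_convergent_prod_imp_convergent_prod summable_imp_abs_convergent_prod)
qed

lemma qpoch_tendsto: "norm q < 1 \<Longrightarrow> qpoch a q \<longlonglongrightarrow> (\<Prod>j. 1 - a * q ^ j)"
  using convergent_prod_LIMSEQ[OF convergent_prod_qpoch]
  by (simp add: qpoch_def[abs_def] LIMSEQ_lessThan_iff_atMost)

lemma qpoch_inf_nonzero: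
  fixes a q :: complex
  assumes "norm q < 1" and "\<And>j. a * q ^ j \<noteq> 1"
  shows "(\<Prod>j. 1 - a * q ^ j) \<noteq> 0"
proof -
  have "1 - a * q ^ j \<noteq> 0" for j using assms(2)[of j] by (metis eq_iff_diff_eq_0)
  then show ?thesis by (intro prodinf_nonzero convergent_prod_qpoch assms(1))
qed

text \<open>Shanks' finite form of Gauss's product for the triangular theta series.\<close>

lemma triangular_theta_finite:
  fixes q :: complex
  assumes q: "norm q < 1"
  defines "P \<equiv> \<lambda>n. qpoch (q ^ 4) (q ^ 4) n / qpoch (q\<^sup>2) (q ^ 4) n"
  shows "(\<Sum>l<2 * n. q ^ (l\<^sup>2 + l)) = (\<Sum>l<n. P n / P l * (q\<^sup>2) ^ (l * (2 * n + 1)))"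
proof (induction n)
  case 0
  show ?case by simp
next
  case (Suc n)
  define x where "x = q\<^sup>2"
  have x: "norm x < 1" unfolding x_def norm_power using q by (simp add: power_less_one_iff)
  have x4: "q ^ 4 = x\<^sup>2" by (simp add: x_def flip: power_mult)
  have nz: "1 - x ^ Suc m \<noteq> 0" for m using power_ne_one[OF x, of "Suc m"] by auto
  have P_Suc: "P (Suc l) = P l * ((1 - x ^ (2 * l + 2)) / (1 - x ^ (2 * l + 1)))" for l
    unfolding P_def x4 x_def[symmetric] qpoch_Suc
    by (simp add: power_mult power_add power2_eq_square power_mult_distrib mult_ac)
  have P0: "P l \<noteq> 0" for l
  proof (induction l)
    case (Suc l)
    then show ?case using nz[of "2 * l + 1"] nz[of "2 * l"] by (simp add: P_Suc)
  qed (simp add: P_def qpoch_def)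
  \<comment> \<open>A telescoping certificate: the change of the l-th summand from n to n + 1 is the
    difference of U in l. The factor 1 - x^(2l) makes U vanish at l = 0.\<close>
  define U where "U = (\<lambda>l. P n / P l * x ^ (l * (2 * n + 1)) * (1 - x ^ (2 * l)) / (1 - x ^ (2 * n + 1)))"
  have tele: "P (Suc n) / P l * x ^ (l * (2 * Suc n + 1)) - P n / P l * x ^ (l * (2 * n + 1)) = U (Suc l) - U l" for l
  proof -
    define X Y Z where "X = x ^ (l * (2 * n + 1))" and "Y = x ^ (2 * l)" and "Z = x ^ (2 * n + 1)"
    have Z: "1 - Z \<noteq> 0" using nz[of "2 * n"] by (simp add: Z_def)
    have Y: "1 - x * Y \<noteq> 0" "1 - x * (x * Y) \<noteq> 0" using nz[of "2 * l"] nz[of "Suc (2 * l)"] by (simp_all add: Y_def)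
    have e: "x ^ (l * (2 * Suc n + 1)) = X * Y" "x ^ (Suc l * (2 * n + 1)) = X * Z" "x ^ (2 * Suc l) = x * (x * Y)"
      "x ^ (2 * l + 1) = x * Y" "x ^ (2 * l + 2) = x * (x * Y)" "x ^ (2 * n + 2) = x * Z"
      by (simp_all add: X_def Y_def Z_def algebra_simps flip: power_add)
    have "P (Suc n) / P l * x ^ (l * (2 * Suc n + 1)) - P n / P l * x ^ (l * (2 * n + 1))
        = P n / P l * (X * ((1 - x * Z) / (1 - Z) * Y - 1))"
      unfolding P_Suc e X_def[symmetric] Z_def[symmetric]
      by (simp only: divide_inverse) (simp add: algebra_simps)
    also have "(1 - x * Z) / (1 - Z) * Y - 1 = (Z * (1 - x * Y) - (1 - Y)) / (1 - Z)"
      using Z by (simp add: field_simps)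
    also have "P n / P l * (X * \<dots>) = U (Suc l) - U l"
    proof -
      have "c / (d * (E / F)) * (X * Z) * E / (1 - Z) - c / d * X * (1 - Y) / (1 - Z)
          = c / d * (X * ((Z * F - (1 - Y)) / (1 - Z)))" if "d \<noteq> 0" "E \<noteq> 0" "F \<noteq> 0" for c d E F
        using that by (simp add: right_diff_distrib diff_divide_distrib mult_ac)
      from this[OF P0[of l] Y(2,1), of "P n"] show ?thesis
        unfolding U_def P_Suc e X_def[symmetric] Y_def[symmetric] Z_def[symmetric] by (rule sym)
    qed
    finally show ?thesis .
  qed
  have "(\<Sum>l<Suc n. P (Suc n) / P l * x ^ (l * (2 * Suc n + 1)))
      - (\<Sum>l<n. P n / P l * x ^ (l * (2 * n + 1)))
      = (\<Sum>l<n. U (Suc l) - U l) + P (Suc n) / P n * x ^ (n * (2 * Suc n + 1))"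
    unfolding tele[symmetric] by (simp add: sum_subtractf)
  also have "\<dots> = U n + P (Suc n) / P n * x ^ (n * (2 * Suc n + 1))"
    unfolding sum_lessThan_telescope by (simp add: U_def)
  also have "\<dots> = x ^ (n * (2 * n + 1)) * (1 + x ^ (2 * n + 1))"
  proof -
    define X Y where "X = x ^ (n * (2 * n + 1))" and "Y = x ^ (2 * n)"
    have Z: "1 - x * Y \<noteq> 0" using nz[of "2 * n"] by (simp add: Y_def)
    have e: "x ^ (n * (2 * Suc n + 1)) = X * Y" "x ^ (2 * n + 1) = x * Y" "x ^ (2 * n + 2) = x * (x * Y)"
      by (simp_all add: X_def Y_def algebra_simps flip: power_add)
    have "X * (1 - Y) / (1 - x * Y) + (1 - x * (x * Y)) / (1 - x * Y) * (X * Y)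
        = X * ((1 - x * Y) * (1 + x * Y)) / (1 - x * Y)"
      by (simp add: algebra_simps flip: add_divide_distrib diff_divide_distrib)
    then show ?thesis
      unfolding U_def P_Suc e X_def[symmetric] Y_def[symmetric] using P0[of n] Z by simp
  qed
  \<comment> \<open>What remains is exactly the pair of new theta terms, with indices 2n and 2n +
    1.\<close>
  also have "\<dots> = (\<Sum>l<2 * Suc n. q ^ (l\<^sup>2 + l)) - (\<Sum>l<2 * n. q ^ (l\<^sup>2 + l))"
    by (simp add: x_def power2_eq_square algebra_simps flip: power_mult power_add)
  finally have "(\<Sum>l<Suc n. P (Suc n) / P l * x ^ (l * (2 * Suc n + 1)))
      - (\<Sum>l<n. P n / P l * x ^ (l * (2 * n + 1)))
      = (\<Sum>l<2 * Suc n. q ^ (l\<^sup>2 + l)) - (\<Sum>l<2 * n. q ^ (l\<^sup>2 + l))" .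
  moreover have "C = A" if "A - B = C - D" "D = B" for A B C D :: complex using that by simp
  ultimately show ?case using Suc.IH unfolding x_def by blast
qed

text \<open>In the finite form the term l = 0 is P n itself, since P 0 = 1. All others carry at
  least the factor (q^2)^(2n+1), and their coefficients P n / P l are bounded because P converges to
  a nonzero limit; together they are O(n |q|^n).\<close>

lemma triangular_theta_sums:
  fixes q :: complex
  assumes q: "norm q < 1"
  shows "summable (\<lambda>l. q ^ (l\<^sup>2 + l))"
    and "(\<lambda>n. qpoch (q ^ 4) (q ^ 4) n / qpoch (q\<^sup>2) (q ^ 4) n) \<longlonglongrightarrow> (\<Sum>l. q ^ (l\<^sup>2 + l))"
proof -
  define P where "P = (\<lambda>n. qpoch (q ^ 4) (q ^ 4) n / qpoch (q\<^sup>2) (q ^ 4) n)"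
  have q4: "norm (q ^ 4) < 1" unfolding norm_power using q by (simp add: power_less_one_iff)
  show sum: "summable (\<lambda>l. q ^ (l\<^sup>2 + l))"
  proof (rule summable_comparison_test')
    show "summable (\<lambda>l. norm q ^ l)" using q by (intro summable_geometric) simp
    show "norm (q ^ (l\<^sup>2 + l)) \<le> norm q ^ l" for l
      unfolding norm_power using q by (intro power_decreasing) auto
  qed
  have ne: "q ^ 4 * (q ^ 4) ^ j \<noteq> 1" "q\<^sup>2 * (q ^ 4) ^ j \<noteq> 1" for j
    using power_ne_one[OF q, of "4 + 4 * j"] power_ne_one[OF q, of "2 + 4 * j"]
    by (simp_all only: power_add power_mult) simp_all
  have lim: "\<exists>l. l \<noteq> 0 \<and> P \<longlonglongrightarrow> l"
  proof (intro exI conjI)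
    show "P \<longlonglongrightarrow> (\<Prod>j. 1 - q ^ 4 * (q ^ 4) ^ j) / (\<Prod>j. 1 - q\<^sup>2 * (q ^ 4) ^ j)"
      unfolding P_def by (intro tendsto_divide qpoch_tendsto qpoch_inf_nonzero q4 ne)
    show "(\<Prod>j. 1 - q ^ 4 * (q ^ 4) ^ j) / (\<Prod>j. 1 - q\<^sup>2 * (q ^ 4) ^ j) \<noteq> 0"
      using qpoch_inf_nonzero[OF q4] ne by (metis divide_eq_0_iff)
  qed
  then obtain l where l: "l \<noteq> 0" "P \<longlonglongrightarrow> l" by blast
  obtain B where B: "\<And>n. norm (P n) \<le> B"
    using convergent_imp_Bseq[OF convergentI[OF l(2)]] by (metis BseqE)
  obtain B' where B': "\<And>n. norm (inverse (P n)) \<le> B'"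
    using convergent_imp_Bseq[OF convergentI[OF tendsto_inverse[OF l(2,1)]]] by (metis BseqE)
  have B0: "B \<ge> 0" "B' \<ge> 0" using order_trans[OF norm_ge_zero B] order_trans[OF norm_ge_zero B'] by auto
  have P0: "P n \<noteq> 0" for n
    unfolding P_def by (simp only: divide_eq_0_iff de_Morgan_disj qpoch_nonzero[OF ne(1)] qpoch_nonzero[OF ne(2)]) simp
  have "(\<lambda>n. (\<Sum>l<2 * Suc n. q ^ (l\<^sup>2 + l)) - P (Suc n)) \<longlonglongrightarrow> 0"
  proof (rule Lim_null_comparison)
    show "\<forall>\<^sub>F n in sequentially. norm ((\<Sum>l<2 * Suc n. q ^ (l\<^sup>2 + l)) - P (Suc n)) \<le> B * B' * (real n * norm q ^ n)"
    proof (intro always_eventually allI)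
      fix n
      have "(\<Sum>l<2 * Suc n. q ^ (l\<^sup>2 + l)) = (\<Sum>l<Suc n. P (Suc n) / P l * (q\<^sup>2) ^ (l * (2 * Suc n + 1)))"
        using triangular_theta_finite[OF q, of "Suc n"] by (simp only: P_def)
      also have "\<dots> = P (Suc n) + (\<Sum>l<n. P (Suc n) / P (Suc l) * (q\<^sup>2) ^ (Suc l * (2 * Suc n + 1)))"
        by (subst sum.lessThan_Suc_shift) (simp add: P_def qpoch_def)
      finally have "norm ((\<Sum>l<2 * Suc n. q ^ (l\<^sup>2 + l)) - P (Suc n))
          \<le> (\<Sum>l<n. norm (P (Suc n) / P (Suc l) * (q\<^sup>2) ^ (Suc l * (2 * Suc n + 1))))"
        by (simp only: add_diff_cancel_left' norm_sum)
      also have "\<dots> \<le> (\<Sum>l<n. B * B' * norm q ^ n)"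
      proof (intro sum_mono)
        fix l
        have "norm ((q\<^sup>2) ^ (Suc l * (2 * Suc n + 1))) = norm q ^ (2 * (Suc l * (2 * Suc n + 1)))"
          by (simp only: norm_power power_mult)
        also have "\<dots> \<le> norm q ^ n" using q by (intro power_decreasing) auto
        finally have 1: "norm ((q\<^sup>2) ^ (Suc l * (2 * Suc n + 1))) \<le> norm q ^ n" .
        have "norm (P (Suc n) / P (Suc l) * (q\<^sup>2) ^ (Suc l * (2 * Suc n + 1)))
          = norm (P (Suc n)) * norm (inverse (P (Suc l))) * norm ((q\<^sup>2) ^ (Suc l * (2 * Suc n + 1)))"
          by (simp only: divide_inverse norm_mult)
        also have "\<dots> \<le> B * B' * norm q ^ n"
          by (intro mult_mono B B' 1 B0 mult_nonneg_nonneg) auto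
        finally show "norm (P (Suc n) / P (Suc l) * (q\<^sup>2) ^ (Suc l * (2 * Suc n + 1))) \<le> B * B' * norm q ^ n" .
      qed
      finally show "norm ((\<Sum>l<2 * Suc n. q ^ (l\<^sup>2 + l)) - P (Suc n)) \<le> B * B' * (real n * norm q ^ n)"
        by (simp add: algebra_simps)
    qed
    have "(\<lambda>n. real n * norm q ^ n) \<longlonglongrightarrow> 0"
      using powser_times_n_limit_0[of "norm q"] q by simp
    then show "(\<lambda>n. B * B' * (real n * norm q ^ n)) \<longlonglongrightarrow> 0"
      by (intro tendsto_mult_right_zero)
  qed
  moreover have "(\<lambda>n. \<Sum>l<2 * Suc n. q ^ (l\<^sup>2 + l)) \<longlonglongrightarrow> (\<Sum>l. q ^ (l\<^sup>2 + l))"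
    using LIMSEQ_subseq_LIMSEQ[OF summable_LIMSEQ[OF sum], of "\<lambda>n. 2 * Suc n"]
    by (simp add: comp_def strict_mono_def)
  ultimately have "(\<lambda>n. P (Suc n)) \<longlonglongrightarrow> (\<Sum>l. q ^ (l\<^sup>2 + l))"
    using tendsto_diff by fastforce
  then show "(\<lambda>n. qpoch (q ^ 4) (q ^ 4) n / qpoch (q\<^sup>2) (q ^ 4) n) \<longlonglongrightarrow> (\<Sum>l. q ^ (l\<^sup>2 + l))"
    unfolding P_def by (subst (asm) filterlim_sequentially_Suc)
qed

text \<open>All three products now have the common base q^4, whose N-th power is 1 at the boundary
  point; this is what allows splitting them by residues modulo N.\<close>

lemma theta_product_eq:
  fixes q :: complex
  assumes q: "norm q < 1" and b: "\<And>m. b powi (-2) * q ^ (4 * m + 4) \<noteq> 1"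
  shows "theta_product b q = (\<Prod>j. 1 - q ^ 4 * (q ^ 4) ^ j) / (\<Prod>j. 1 - q\<^sup>2 * (q ^ 4) ^ j)
    / (\<Prod>j. 1 - b powi (-2) * q ^ 4 * (q ^ 4) ^ j)"
proof -
  define a where "a = b powi (-2) * q ^ 4"
  have q4: "norm (q ^ 4) < 1" unfolding norm_power using q by (simp add: power_less_one_iff)
  have e: "b powi (-2) * q ^ (4 * m + 4) = a * (q ^ 4) ^ m" for m
    by (simp only: a_def power_add power_mult) (simp add: mult_ac)
  have nz: "(\<Prod>j. 1 - a * (q ^ 4) ^ j) \<noteq> 0"
    using b unfolding e by (intro qpoch_inf_nonzero q4) auto
  have "convergent_prod (\<lambda>j. 1 - a * (q ^ 4) ^ j)" by (rule convergent_prod_qpoch[OF q4])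
  then have "(\<Prod>m. 1 / (1 - a * (q ^ 4) ^ m)) = inverse (\<Prod>j. 1 - a * (q ^ 4) ^ j)"
    by (subst prodinf_inverse[symmetric]) (auto simp: divide_inverse)
  then have "theta_product b q = (\<Sum>l. q ^ (l\<^sup>2 + l)) / (\<Prod>j. 1 - a * (q ^ 4) ^ j)"
    unfolding theta_product_def e by (simp add: divide_inverse)
  moreover have "q\<^sup>2 * (q ^ 4) ^ j \<noteq> 1" for j
    using power_ne_one[OF q, of "2 + 4 * j"] by (simp only: power_add power_mult) simp
  then have "(\<lambda>n. qpoch (q ^ 4) (q ^ 4) n / qpoch (q\<^sup>2) (q ^ 4) n)
      \<longlonglongrightarrow> (\<Prod>j. 1 - q ^ 4 * (q ^ 4) ^ j) / (\<Prod>j. 1 - q\<^sup>2 * (q ^ 4) ^ j)"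
    by (intro tendsto_divide qpoch_tendsto q4 qpoch_inf_nonzero)
  then have "(\<Sum>l. q ^ (l\<^sup>2 + l)) = (\<Prod>j. 1 - q ^ 4 * (q ^ 4) ^ j) / (\<Prod>j. 1 - q\<^sup>2 * (q ^ 4) ^ j)"
    by (rule LIMSEQ_unique[OF triangular_theta_sums(2)[OF q]])
  ultimately show ?thesis by (simp only: a_def)
qed

subsection \<open>The dilogarithm on the slit plane\<close>

text \<open>The complement of [1, oo), phrased through the branch cut of
  \<open>Ln (1 - z)\<close>.\<close>

definition slit_plane :: "complex set" where
  "slit_plane = {z. 1 - z \<notin> \<real>\<^sub>\<le>\<^sub>0}"

definition dilog_deriv :: "complex \<Rightarrow> complex" where
  "dilog_deriv z = (if z = 0 then 1 else - Ln (1 - z) / z)"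

text \<open>The principal branch of Li_2, obtained as a primitive on a starlike domain. This covers
  arguments of modulus greater than 1 directly.\<close>

definition dilog :: "complex \<Rightarrow> complex" where
  "dilog = (SOME L. L 0 = 0 \<and> (\<forall>z\<in>slit_plane. (L has_field_derivative dilog_deriv z) (at z)))"

lemma slit_plane_iff: "z \<in> slit_plane \<longleftrightarrow> Im z \<noteq> 0 \<or> Re z < 1"
  by (auto simp: slit_plane_def complex_nonpos_Reals_iff)

lemma open_slit_plane: "open slit_plane"
proof -
  have "slit_plane = - ((\<lambda>z. 1 - z) -` \<real>\<^sub>\<le>\<^sub>0)" by (auto simp: slit_plane_def)
  moreover have "closed ((\<lambda>z::complex. 1 - z) -` \<real>\<^sub>\<le>\<^sub>0)"
    by (intro continuous_closed_vimage closed_nonpos_Reals_complex continuous_intros)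
  ultimately show ?thesis by (metis open_Compl)
qed

lemma zero_in_slit_plane [simp]: "0 \<in> slit_plane" by (simp add: slit_plane_iff)

lemma scale_slit_plane:
  assumes "z \<in> slit_plane" "0 \<le> t" "t \<le> 1" shows "of_real t * z \<in> slit_plane"
proof (cases "Im z = 0 \<or> t = 0")
  case True
  then have "t = 0 \<or> Re z < 1" using assms by (auto simp: slit_plane_iff)
  moreover have "t * Re z < 1" if "Re z < 1"
  proof (cases "Re z > 0")
    case True
    then have "t * Re z \<le> 1 * Re z" using assms by (intro mult_right_mono) auto
    then show ?thesis using that by simp
  next
    case False
    then have "t * Re z \<le> 0" using assms by (simp add: mult_nonneg_nonpos)
    then show ?thesis by simp
  qed
  ultimately show ?thesis by (auto simp: slit_plane_iff)
qed (use assms in \<open>auto simp: slit_plane_iff\<close>)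

lemma starlike_slit_plane: "starlike slit_plane"
  unfolding starlike_def
proof (intro bexI[of _ 0] ballI)
  fix z assume "z \<in> slit_plane"
  then show "closed_segment 0 z \<subseteq> slit_plane"
    using scale_slit_plane[of z] by (auto simp: in_segment scaleR_conv_of_real)
qed simp

lemma continuous_on_dilog_deriv: "continuous_on slit_plane dilog_deriv"
proof -
  have "isCont dilog_deriv z" if z: "z \<in> slit_plane" for z
  proof (cases "z = 0")
    case True
    have "((\<lambda>z. Ln (1 - z)) has_field_derivative - 1) (at 0)"
      by (auto intro!: derivative_eq_intros simp: complex_nonpos_Reals_iff)
    then have "((\<lambda>z. - (Ln (1 - z) / z)) \<longlongrightarrow> - (-1)) (at 0)"
      by (intro tendsto_minus) (simp add: has_field_derivative_iff)
    moreover have "\<forall>\<^sub>F z in at 0. - (Ln (1 - z) / z) = dilog_deriv z"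
      by (auto simp: dilog_deriv_def eventually_at_filter)
    ultimately have "(dilog_deriv \<longlongrightarrow> 1) (at 0)"
      by (simp add: tendsto_cong)
    then show ?thesis using True by (simp add: isCont_def dilog_deriv_def)
  next
    case False
    have "isCont (\<lambda>z. - Ln (1 - z) / z) z"
      using z False by (intro continuous_intros) (auto simp: slit_plane_def)
    moreover have "\<forall>\<^sub>F x in nhds z. dilog_deriv x = - Ln (1 - x) / x"
      using t1_space_nhds[OF False] by (rule eventually_mono) (simp add: dilog_deriv_def)
    ultimately show ?thesis by (simp add: isCont_cong)
  qed
  then show ?thesis by (simp add: continuous_at_imp_continuous_on)
qed

lemma dilog_props: "dilog 0 = 0 \<and> (\<forall>z\<in>slit_plane. (dilog has_field_derivative dilog_deriv z) (at z))"
proof -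
  have fd: "dilog_deriv field_differentiable at z" if "z \<in> slit_plane - {0}" for z
  proof -
    have "\<exists>D. ((\<lambda>z. - Ln (1 - z) / z) has_field_derivative D) (at z)"
      using that by (intro exI) (auto intro!: derivative_eq_intros simp: slit_plane_def)
    then have "(\<lambda>z. - Ln (1 - z) / z) field_differentiable at z"
      by (simp add: field_differentiable_def)
    moreover have "\<forall>\<^sub>F x in nhds z. - Ln (1 - x) / x = dilog_deriv x"
      using t1_space_nhds[of z 0] that by (auto elim!: eventually_mono simp: dilog_deriv_def)
    ultimately show ?thesis
      unfolding field_differentiable_def by (metis DERIV_cong_ev)
  qed
  \<comment> \<open>The removable singularity 0 goes into the exceptional set, where the primitive
    theorem asks for continuity only.\<close>
  obtain L where L: "\<And>z. z \<in> slit_plane \<Longrightarrow> (L has_field_derivative dilog_deriv z) (at z)"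
    using holomorphic_starlike_primitive[OF continuous_on_dilog_deriv starlike_slit_plane open_slit_plane _ fd, of "{0}"]
    by auto
  have "\<exists>L. L 0 = 0 \<and> (\<forall>z\<in>slit_plane. (L has_field_derivative dilog_deriv z) (at z))"
    by (rule exI[of _ "\<lambda>z. L z - L 0"]) (auto intro!: derivative_eq_intros L)
  then show ?thesis unfolding dilog_def by (rule someI_ex)
qed

lemma dilog_0 [simp]: "dilog 0 = 0"
  and has_field_derivative_dilog: "z \<in> slit_plane \<Longrightarrow> (dilog has_field_derivative dilog_deriv z) (at z)"
  using dilog_props by auto

lemma isCont_dilog: "z \<in> slit_plane \<Longrightarrow> isCont dilog z"
  using has_field_derivative_dilog by (blast intro: DERIV_isCont)

lemma has_real_derivative_Re_line:
  assumes "(f has_field_derivative D) (at (a + of_real t * d))"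
  shows "((\<lambda>t. Re (f (a + of_real t * d))) has_real_derivative Re (D * d)) (at t)"
proof -
  have "((\<lambda>t. a + of_real t * d) has_vector_derivative d) (at t)"
    by (auto intro!: derivative_eq_intros simp: has_vector_derivative_def scaleR_conv_of_real)
  from field_vector_diff_chain_at[OF this assms]
  have "((\<lambda>t. f (a + of_real t * d)) has_vector_derivative (d * D)) (at t)"
    by (simp add: comp_def)
  from bounded_linear.has_vector_derivative[OF bounded_linear_Re this]
  show ?thesis by (simp add: has_real_derivative_iff_has_vector_derivative mult.commute)
qed

text \<open>Along a ray the real part of Li_2 integrates the logarithm of a modulus. This is the
  bridge from sums of ln |1 - t z| to dilogarithms.\<close>

lemma has_real_derivative_dilog_ray:
  assumes "of_real t * z \<in> slit_plane" "t > 0"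
  shows "((\<lambda>t. Re (dilog (of_real t * z))) has_real_derivative - ln (norm (1 - of_real t * z)) / t) (at t)"
proof (cases "z = 0")
  case False
  have ne: "1 - of_real t * z \<noteq> 0" using assms by (auto simp: slit_plane_def)
  have "dilog_deriv (of_real t * z) * z = - Ln (1 - of_real t * z) / of_real t"
    using False assms by (simp add: dilog_deriv_def)
  then have "Re (dilog_deriv (of_real t * z) * z) = - ln (norm (1 - of_real t * z)) / t"
    using ne by (simp add: Re_divide_of_real)
  moreover have "((\<lambda>t. Re (dilog (of_real t * z))) has_real_derivative Re (dilog_deriv (of_real t * z) * z)) (at t)"
    using has_real_derivative_Re_line[of dilog "dilog_deriv (of_real t * z)" 0 t z]
      has_field_derivative_dilog[OF assms(1)] by (simp only: add_0_left)
  ultimately show ?thesis by metis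
qed simp

lemma continuous_on_dilog_ray:
  assumes "z \<in> slit_plane"
  shows "continuous_on {0..1} (\<lambda>t. Re (dilog (of_real t * z)))"
proof (rule continuous_at_imp_continuous_on, rule ballI)
  fix t :: real assume t: "t \<in> {0..1}"
  then have "isCont dilog (of_real t * z)"
    by (intro isCont_dilog scale_slit_plane assms) auto
  then have "isCont (\<lambda>t. dilog (of_real t * z)) t"
    by (rule isCont_o2[where g = dilog, rotated]) (intro continuous_intros)
  then show "isCont (\<lambda>t. Re (dilog (of_real t * z))) t"
    by (rule isCont_Re)
qed

text \<open>Along a ray both sides have the same derivative, because the product of 1 - t y w^i over
  i is 1 - (t y)^n; at t = 0 both vanish. The rays stay off the cut: if y w^i were real and at least
  1, so would be its n-th power y^n.\<close>

lemma dilog_distribution: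
  assumes inj: "inj_on (\<lambda>j. w ^ j) {..<n}" and w: "w ^ n = 1" and n: "n > 0"
    and y: "y ^ n \<in> slit_plane"
  shows "y * w ^ i \<in> slit_plane"
    and "(\<Sum>i<n. Re (dilog (y * w ^ i))) = Re (dilog (y ^ n)) / n"
proof -
  have wn: "(w ^ i) ^ n = 1" for i using w by (metis power_mult mult.commute power_one)
  have slit: "y * w ^ i \<in> slit_plane" for i
  proof (rule ccontr)
    assume "y * w ^ i \<notin> slit_plane"
    then have "y * w ^ i = of_real (Re (y * w ^ i))" and 1: "Re (y * w ^ i) \<ge> 1"
      by (auto simp: slit_plane_iff complex_eq_iff)
    then have "(y * w ^ i) ^ n = of_real (Re (y * w ^ i) ^ n)" by (metis of_real_power)
    then have "y ^ n = of_real (Re (y * w ^ i) ^ n)" by (simp add: power_mult_distrib wn)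
    moreover have "Re (y * w ^ i) ^ n \<ge> 1" using 1 by simp
    ultimately show False using y by (simp add: slit_plane_iff)
  qed
  then show "y * w ^ i \<in> slit_plane" .
  define F where "F = (\<lambda>t::real. (\<Sum>i<n. Re (dilog (of_real t * (y * w ^ i)))) - Re (dilog (of_real (t ^ n) * y ^ n)) / n)"
  have "F 1 = F 0"
  proof (rule DERIV_isconst_end[where f = F and a = 0 and b = 1])
    show "continuous_on {0..1} F"
    proof -
      have "continuous_on {0..1} (\<lambda>x. Re (dilog (of_real (x ^ n) * y ^ n)))"
        by (rule continuous_on_compose2[OF continuous_on_dilog_ray[OF y]])
           (auto intro!: continuous_intros power_le_one)
      then show ?thesis
        unfolding F_def using n by (intro continuous_on_diff continuous_on_sum continuous_on_divide
          continuous_on_const continuous_on_dilog_ray slit) auto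
    qed
    fix t :: real assume t: "0 < t" "t < 1"
    have tn: "0 < t ^ n" "t ^ n \<le> 1" using t by (auto intro: power_le_one)
    have "(\<Prod>i<n. 1 - of_real t * (y * w ^ i)) = 1 - (of_real t * y) ^ n"
      using prod_one_minus_roots[OF inj w n, of "of_real t * y"] by (simp add: mult.assoc)
    then have "(\<Prod>i<n. norm (1 - of_real t * (y * w ^ i))) = norm (1 - of_real (t ^ n) * y ^ n)"
      by (simp add: power_mult_distrib prod_norm)
    moreover have "norm (1 - of_real t * (y * w ^ i)) > 0" for i
      using scale_slit_plane[OF slit[of i], of t] t by (auto simp: slit_plane_def)
    ultimately have ln: "(\<Sum>i<n. ln (norm (1 - of_real t * (y * w ^ i)))) = ln (norm (1 - of_real (t ^ n) * y ^ n))"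
      using ln_prod[of "{..<n}" "\<lambda>i. norm (1 - of_real t * (y * w ^ i))"] by simp
    have d1: "((\<lambda>t. \<Sum>i<n. Re (dilog (of_real t * (y * w ^ i)))) has_real_derivative
        (\<Sum>i<n. - ln (norm (1 - of_real t * (y * w ^ i))) / t)) (at t)"
      using t by (intro DERIV_sum has_real_derivative_dilog_ray scale_slit_plane slit) auto
    have "((\<lambda>t. Re (dilog (of_real (t ^ n) * y ^ n))) has_real_derivative
        (- ln (norm (1 - of_real (t ^ n) * y ^ n)) / t ^ n) * (real n * t ^ (n - 1))) (at t)"
    proof (rule DERIV_chain2[where f = "\<lambda>s. Re (dilog (of_real s * y ^ n))"])
      show "((\<lambda>s. Re (dilog (of_real s * y ^ n))) has_real_derivative
          - ln (norm (1 - of_real (t ^ n) * y ^ n)) / t ^ n) (at (t ^ n))"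
        using tn by (intro has_real_derivative_dilog_ray scale_slit_plane y) auto
      show "((\<lambda>t. t ^ n) has_real_derivative real n * t ^ (n - 1)) (at t)"
        by (auto intro!: derivative_eq_intros)
    qed
    from DERIV_diff[OF d1 DERIV_cdivide[OF this, of "real n"]]
    have "(F has_real_derivative (\<Sum>i<n. - ln (norm (1 - of_real t * (y * w ^ i))) / t) -
       (- ln (norm (1 - of_real (t ^ n) * y ^ n)) / t ^ n) * (real n * t ^ (n - 1)) / real n) (at t)"
      unfolding F_def .
    moreover have "(\<Sum>i<n. - ln (norm (1 - of_real t * (y * w ^ i))) / t) = - ln (norm (1 - of_real (t ^ n) * y ^ n)) / t"
      unfolding ln[symmetric] by (simp add: sum_divide_distrib sum_negf)
    moreover have "l / t ^ n * (real n * t ^ (n - 1)) / real n = l / t" for l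
      using n t by (cases n) (simp_all add: divide_simps del: of_nat_Suc)
    ultimately show "(F has_real_derivative 0) (at t)" by (metis diff_self)
  qed simp
  also have "F 0 = 0" using n by (simp add: F_def power_0_left)
  finally show "(\<Sum>i<n. Re (dilog (y * w ^ i))) = Re (dilog (y ^ n)) / n" by (simp add: F_def)
qed

text \<open>In the coordinate \<open>z = 1 - exp L\<close> the derivative of the dilogarithm is the elementary
  function \<open>L / (exp (-L) - 1)\<close> on the strip \<open>\<bar>Im L\<bar> < \<pi>\<close>.\<close>

lemma has_field_derivative_dilog_exp:
  assumes "\<bar>Im L\<bar> < pi"
  shows "((\<lambda>L. dilog (1 - exp L)) has_field_derivative (if L = 0 then -1 else L / (exp (- L) - 1))) (at L)"
proof -
  have Ln: "Ln (exp L) = L" using assms by (intro Ln_exp) auto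
  have npos: "exp L \<notin> \<real>\<^sub>\<le>\<^sub>0"
  proof
    assume "exp L \<in> \<real>\<^sub>\<le>\<^sub>0"
    moreover have "Re (exp L) \<noteq> 0 \<or> Im (exp L) \<noteq> 0"
      using exp_not_eq_zero[of L] by (metis complex_eq_iff zero_complex.sel)
    ultimately have "Im (Ln (exp L)) = pi"
      by (subst Im_Ln_eq_pi) (auto simp: complex_nonpos_Reals_iff order.order_iff_strict)
    then show False using assms unfolding Ln by simp
  qed
  have slit: "1 - exp L \<in> slit_plane" using npos by (simp add: slit_plane_def)
  have "((\<lambda>L. 1 - exp L) has_field_derivative (- exp L)) (at L)"
    by (auto intro!: derivative_eq_intros)
  from DERIV_chain2[OF has_field_derivative_dilog[OF slit] this]
  have "((\<lambda>L. dilog (1 - exp L)) has_field_derivative dilog_deriv (1 - exp L) * - exp L) (at L)" .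
  moreover have "dilog_deriv (1 - exp L) * - exp L = (if L = 0 then -1 else L / (exp (- L) - 1))"
  proof (cases "L = 0")
    case False
    then have "exp L \<noteq> 1" using Ln by (metis Ln_1)
    then show ?thesis using False
      by (auto simp: dilog_deriv_def Ln exp_minus divide_simps)
  qed (simp add: dilog_deriv_def)
  ultimately show ?thesis by simp
qed

text \<open>On the circle |1 - z| = 1 the coordinate L = i p is imaginary, and 1/(exp(-L) - 1) has
  real part -1/2 for every p that is not a multiple of 2 pi. So the real part of the dilogarithm has
  derivative p/2 in p.\<close>

lemma Re_dilog_unit_circle:
  assumes "\<bar>\<phi>\<bar> < pi"
  shows "Re (dilog (1 - exp (\<i> * of_real \<phi>))) = \<phi>\<^sup>2 / 4"
proof -
  define G where "G = (\<lambda>t. Re (dilog (1 - exp (0 + of_real t * (\<i> * of_real \<phi>)))) - (t * \<phi>)\<^sup>2 / 4)"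
  have deriv: "(G has_real_derivative 0) (at t)" if t: "0 \<le> t" "t \<le> 1" for t
  proof -
    define p where "p = t * \<phi>"
    have "\<bar>p\<bar> \<le> 1 * \<bar>\<phi>\<bar>" unfolding p_def abs_mult using t by (intro mult_right_mono) auto
    then have p: "\<bar>p\<bar> < pi" using assms by simp
    define L where "L = \<i> * of_real p"
    have L: "0 + of_real t * (\<i> * of_real \<phi>) = L" by (simp add: L_def p_def mult_ac)
    define D where "D = (if L = 0 then -1 else L / (exp (- L) - 1))"
    have "((\<lambda>L. dilog (1 - exp L)) has_field_derivative D) (at L)"
      unfolding D_def by (rule has_field_derivative_dilog_exp) (use p in \<open>simp add: L_def\<close>)
    then have "((\<lambda>L. dilog (1 - exp L)) has_field_derivative D) (at (0 + of_real t * (\<i> * of_real \<phi>)))"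
      unfolding L .
    from has_real_derivative_Re_line[OF this]
    have d1: "((\<lambda>t. Re (dilog (1 - exp (0 + of_real t * (\<i> * of_real \<phi>))))) has_real_derivative
        Re (D * (\<i> * of_real \<phi>))) (at t)" .
    have d2: "((\<lambda>t. (t * \<phi>)\<^sup>2 / 4) has_real_derivative (p * \<phi> / 2)) (at t)"
      by (auto intro!: derivative_eq_intros simp: p_def)
    have "Re (D * (\<i> * of_real \<phi>)) = p * \<phi> / 2"
    proof (cases "L = 0")
      case True
      then show ?thesis by (simp add: D_def L_def)
    next
      case False
      then have p0: "p \<noteq> 0" by (simp add: L_def)
      have cos1: "cos p \<noteq> 1"
      proof
        assume "cos p = 1"
        then obtain n where "p = of_int n * 2 * pi" by (auto simp: cos_one_2pi_int)
        then have "\<bar>of_int n\<bar> * (2 * pi) < pi" "n \<noteq> 0" using p p0 by (auto simp: abs_mult)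
        moreover have "1 * (2 * pi) \<le> \<bar>of_int n :: real\<bar> * (2 * pi)" using \<open>n \<noteq> 0\<close>
          by (intro mult_right_mono) auto
        ultimately show False using pi_gt_zero by simp
      qed
      define E where "E = exp (- L) - 1"
      have E: "Re E = cos p - 1" "Im E = - sin p"
        by (simp_all add: E_def L_def Re_exp Im_exp)
      have n2: "(Re E)\<^sup>2 + (Im E)\<^sup>2 = 2 * (1 - cos p)"
        unfolding E using sin_cos_squared_add[of p] by (simp add: power2_eq_square algebra_simps)
      have "D * (\<i> * of_real \<phi>) = of_real (- (p * \<phi>)) / E"
        using False by (simp add: D_def E_def L_def algebra_simps)
      then have "Re (D * (\<i> * of_real \<phi>)) = - (p * \<phi>) * Re E / ((Re E)\<^sup>2 + (Im E)\<^sup>2)"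
        by (simp add: Re_divide)
      also have "\<dots> = p * \<phi> / 2" unfolding n2 unfolding E using cos1 by (simp add: divide_simps) (simp add: algebra_simps)
      finally show ?thesis .
    qed
    moreover have "(G has_real_derivative (Re (D * (\<i> * of_real \<phi>)) - p * \<phi> / 2)) (at t)"
      unfolding G_def by (rule DERIV_diff[OF d1 d2])
    ultimately show ?thesis by (metis diff_self)
  qed
  have "G 1 = G 0"
    by (rule DERIV_isconst_end[where f = G and a = 0 and b = 1])
       (blast intro: DERIV_atLeastAtMost_imp_continuous_on deriv less_imp_le zero_less_one)+
  then show ?thesis by (simp add: G_def)
qed

text \<open>With Ln (1 - c) = a + i \<phi>, the hypothesis says a >= 0. On the horizontal line from
  i \<phi> the real part of L / (exp(-L) - 1) is never positive: its numerator t Re E + \<phi> Im E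
  is a sum of two nonpositive terms. Hence the value at c is at most the one on the circle,
  \<phi>^2/4, and |\<phi>| < pi off the cut.\<close>

lemma Re_dilog_less:
  assumes c: "c \<in> slit_plane" and n: "norm (1 - c) \<ge> 1"
  shows "Re (dilog c) < pi\<^sup>2 / 4"
proof -
  have ne: "1 - c \<noteq> 0" using n by auto
  define a \<phi> where "a = ln (norm (1 - c))" and "\<phi> = Im (Ln (1 - c))"
  have a0: "a \<ge> 0" using n by (simp add: a_def)
  have "\<phi> \<noteq> pi" using c by (auto simp: \<phi>_def Im_Ln_eq_pi[OF ne] slit_plane_iff)
  then have \<phi>: "\<bar>\<phi>\<bar> < pi" using mpi_less_Im_Ln[OF ne] Im_Ln_le_pi[OF ne] by (auto simp: \<phi>_def)
  have Ln: "Ln (1 - c) = \<i> * of_real \<phi> + of_real a * 1"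
    using ne by (auto simp: complex_eq_iff a_def \<phi>_def)
  define G where "G = (\<lambda>t. Re (dilog (1 - exp (\<i> * of_real \<phi> + of_real t * 1))))"
  have deriv: "\<exists>D. (G has_real_derivative D) (at t) \<and> D \<le> 0" if t: "0 \<le> t" for t
  proof -
    define L where "L = \<i> * of_real \<phi> + of_real t * 1"
    define D where "D = (if L = 0 then -1 else L / (exp (- L) - 1))"
    have "((\<lambda>L. dilog (1 - exp L)) has_field_derivative D) (at L)"
      unfolding D_def by (rule has_field_derivative_dilog_exp) (use \<phi> in \<open>simp add: L_def\<close>)
    then have "(G has_real_derivative Re (D * 1)) (at t)"
      unfolding L_def G_def by (rule has_real_derivative_Re_line)
    moreover have "Re D \<le> 0"
    proof (cases "L = 0")
      case False
      define E where "E = exp (- L) - 1"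
      have E: "Re E = exp (- t) * cos \<phi> - 1" "Im E = - (exp (- t) * sin \<phi>)"
        by (simp_all add: E_def L_def Re_exp Im_exp)
      have "exp (- t) * cos \<phi> \<le> exp (- t) * 1"
        by (intro mult_left_mono) auto
      also have "\<dots> \<le> 1" using t by simp
      finally have "t * Re E \<le> 0" unfolding E using t by (intro mult_nonneg_nonpos) auto
      moreover have "0 \<le> \<phi> * sin \<phi>"
      proof (cases "\<phi> \<ge> 0")
        case True
        then show ?thesis using \<phi> by (intro mult_nonneg_nonneg sin_ge_zero) auto
      next
        case False
        then have "0 \<le> (- \<phi>) * sin (- \<phi>)" using \<phi> by (intro mult_nonneg_nonneg sin_ge_zero) auto
        then show ?thesis by simp
      qed
      then have "0 \<le> exp (- t) * (\<phi> * sin \<phi>)" by simp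
      then have "\<phi> * Im E \<le> 0" unfolding E by (simp add: mult.left_commute)
      moreover have "Re D = (t * Re E + \<phi> * Im E) / ((Re E)\<^sup>2 + (Im E)\<^sup>2)"
        using False by (simp add: D_def E_def[symmetric] Re_divide) (simp add: L_def)
      ultimately show ?thesis by (auto intro!: divide_nonpos_nonneg)
    qed (simp add: D_def)
    ultimately show ?thesis by auto
  qed
  have "G a \<le> G 0"
    using a0 deriv by (intro DERIV_nonpos_imp_nonincreasing[where f = G]) blast+
  also have "G 0 = \<phi>\<^sup>2 / 4" using Re_dilog_unit_circle[OF \<phi>] by (simp add: G_def)
  also have "\<dots> < pi\<^sup>2 / 4"
    using power_strict_mono[OF \<phi>, of 2] by simp
  also have "G a = Re (dilog (1 - exp (Ln (1 - c))))" unfolding G_def Ln ..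
  also have "\<dots> = Re (dilog c)" using ne by simp
  finally show ?thesis .
qed

text \<open>Comparison of derivatives: partial sums of the series of -ln (1 - t) lie below it since
  its terms are nonnegative. Finite sums are continuous at y = 1, where the bound is going to be
  used.\<close>

lemma Re_dilog_ge_partial_sum:
  assumes y: "0 < y" "y < 1"
  shows "(\<Sum>n<K. y ^ n / (real n)\<^sup>2) \<le> Re (dilog (of_real y))"
proof -
  define G where "G = (\<lambda>t. Re (dilog (of_real t * 1)) - (\<Sum>n<K. t ^ n / (real n)\<^sup>2))"
  have "G 0 \<le> G y"
  proof (rule DERIV_nonneg_imp_increasing_open[where f = G])
    have "continuous_on {0..y} (\<lambda>t. \<Sum>n<K. t ^ n / (real n)\<^sup>2)"
      unfolding divide_inverse by (intro continuous_intros)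
    moreover have "continuous_on {0..y} (\<lambda>t. Re (dilog (of_real t * 1)))"
    proof (rule continuous_at_imp_continuous_on, rule ballI)
      fix t assume "t \<in> {0..y}"
      then have "isCont dilog (of_real t * 1)"
        using y by (intro isCont_dilog) (auto simp: slit_plane_iff)
      then have "isCont (\<lambda>t. dilog (of_real t * 1)) t"
        by (rule isCont_o2[where g = dilog, rotated]) (intro continuous_intros)
      then show "isCont (\<lambda>t. Re (dilog (of_real t * 1))) t" by (rule isCont_Re)
    qed
    ultimately show "continuous_on {0..y} G" unfolding G_def by (intro continuous_on_diff)
    fix t assume t: "0 < t" "t < y"
    then have t1: "t < 1" using y by simp
    have "((\<lambda>t. Re (dilog (of_real t * 1))) has_real_derivative - ln (norm (1 - of_real t * 1 :: complex)) / t) (at t)"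
      using t t1 by (intro has_real_derivative_dilog_ray) (auto simp: slit_plane_iff)
    moreover have "norm (1 - of_real t * 1 :: complex) = 1 - t"
      using t1 by (metis abs_of_pos diff_gt_0_iff_gt mult.right_neutral norm_of_real of_real_1 of_real_diff)
    ultimately have d1: "((\<lambda>t. Re (dilog (of_real t * 1))) has_real_derivative - ln (1 - t) / t) (at t)" by simp
    have d2: "((\<lambda>t. \<Sum>n<K. t ^ n / (real n)\<^sup>2) has_real_derivative (\<Sum>n<K. real n * t ^ (n - 1) / (real n)\<^sup>2)) (at t)"
      by (intro DERIV_sum DERIV_cdivide) (auto intro!: derivative_eq_intros)
    have e: "real n * t ^ (n - 1) / (real n)\<^sup>2 = t ^ n / real n / t" for n
      using t by (cases n) (simp_all add: power2_eq_square del: of_nat_Suc)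
    have "(\<lambda>n. - ((- (- t)) ^ n) / of_nat n) sums ln (1 + (- t))"
      using t t1 by (intro ln_series') auto
    from sums_minus[OF this] have "(\<lambda>n. t ^ n / real n) sums - ln (1 - t)" by simp
    then have "(\<Sum>n<K. t ^ n / real n) \<le> - ln (1 - t)"
      using t by (subst sums_unique[of _ "- ln (1 - t)"]) (auto intro!: sum_le_suminf dest: sums_summable)
    then have "(\<Sum>n<K. real n * t ^ (n - 1) / (real n)\<^sup>2) \<le> - ln (1 - t) / t"
      unfolding e sum_divide_distrib[symmetric] using t by (intro divide_right_mono) auto
    with DERIV_diff[OF d1 d2] show "\<exists>D. (G has_real_derivative D) (at t) \<and> D \<ge> 0"
      unfolding G_def by (intro exI conjI) auto
  qed (use y in auto)
  \<comment> \<open>The summand n = 0 is 1/0 = 0, so the sum effectively starts at n = 1.\<close>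
  also have "G 0 = 0" by (auto simp: G_def intro!: sum.neutral)
  finally show ?thesis by (simp add: G_def)
qed

text \<open>A substitute for Li_2(1) = pi^2/6 at the branch point: Euler's sum of inverse squares,
  truncated far enough, then y close to 1.\<close>

lemma Re_dilog_near_1:
  assumes "\<epsilon> > 0"
  shows "\<forall>\<^sub>F y in at_left 1. Re (dilog (of_real y)) > pi\<^sup>2 / 6 - \<epsilon>"
proof -
  have "(\<lambda>n. 1 / (real (Suc n))\<^sup>2) sums (pi\<^sup>2 / 6)"
    using inverse_squares_sums by (simp del: of_nat_Suc)
  then have "(\<lambda>n. 1 / (real n)\<^sup>2) sums (pi\<^sup>2 / 6 + 1 / (real 0)\<^sup>2)"
    by (subst (asm) sums_Suc_iff)
  then have "(\<lambda>n. 1 / (real n)\<^sup>2) sums (pi\<^sup>2 / 6)" by simp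
  then have "(\<lambda>K. \<Sum>n<K. 1 / (real n)\<^sup>2) \<longlonglongrightarrow> pi\<^sup>2 / 6" by (simp add: sums_def)
  then have "\<forall>\<^sub>F K in sequentially. (\<Sum>n<K. 1 / (real n)\<^sup>2) > pi\<^sup>2 / 6 - \<epsilon>"
    using assms by (intro order_tendstoD) auto
  then obtain K where K: "(\<Sum>n<K. 1 / (real n)\<^sup>2) > pi\<^sup>2 / 6 - \<epsilon>"
    by (auto simp: eventually_at_top_linorder)
  have "((\<lambda>y. \<Sum>n<K. y ^ n / (real n)\<^sup>2) \<longlongrightarrow> (\<Sum>n<K. 1 ^ n / (real n)\<^sup>2)) (at_left 1)"
    by (intro tendsto_sum) (simp only: divide_inverse, intro tendsto_intros)
  then have "\<forall>\<^sub>F y in at_left 1. (\<Sum>n<K. y ^ n / (real n)\<^sup>2) > pi\<^sup>2 / 6 - \<epsilon>"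
    using K by (intro order_tendstoD) auto
  moreover have "\<forall>\<^sub>F y in at_left (1::real). 0 < y \<and> y < 1"
    by (rule eventually_at_leftI[of 0]) auto
  ultimately show ?thesis
    by eventually_elim (blast intro: less_le_trans Re_dilog_ge_partial_sum)
qed

text \<open>Distribution for the roots 1, -1 gives Li_2(y) + Li_2(-y) = Li_2(y^2)/2, and Li_2(y^2)
  <= Li_2(y) by monotonicity. So Li_2(-y) <= -Li_2(y)/2; let y tend to 1.\<close>

lemma Re_dilog_minus_1: "Re (dilog (-1)) \<le> - (pi\<^sup>2 / 12)"
proof (rule field_le_epsilon)
  fix e :: real assume e: "e > 0"
  have "isCont dilog (-1)" by (rule isCont_dilog) (simp add: slit_plane_iff)
  then have "isCont dilog (- of_real 1)" by simp
  then have "isCont (\<lambda>y. dilog (- of_real y)) (1 :: real)"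
    by (rule isCont_o2[where g = dilog, rotated]) (intro continuous_intros)
  then have "isCont (\<lambda>y. Re (dilog (- of_real y))) (1 :: real)" by (rule isCont_Re)
  then have "((\<lambda>y::real. Re (dilog (- of_real y))) \<longlongrightarrow> Re (dilog (-1))) (at_left 1)"
    by (simp add: isCont_def filterlim_at_split)
  moreover have "\<forall>\<^sub>F y in at_left (1::real). Re (dilog (- of_real y)) \<le> - (pi\<^sup>2 / 12) + e"
  proof -
    have "\<forall>\<^sub>F y in at_left (1::real). 0 < y \<and> y < 1"
      by (rule eventually_at_leftI[of 0]) auto
    then show ?thesis using Re_dilog_near_1[OF e]
    proof eventually_elim
      case (elim y)
      have "(\<Sum>i<2. Re (dilog (of_real y * (-1) ^ i))) = Re (dilog (of_real y ^ 2)) / 2"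
      proof -
        have "inj_on (\<lambda>j. (-1 :: complex) ^ j) {..<2}"
          by (auto simp: inj_on_def numeral_2_eq_2 less_Suc_eq)
        moreover have "(of_real y :: complex) ^ 2 \<in> slit_plane"
          using elim(1) by (auto simp: slit_plane_iff power_less_one_iff simp flip: of_real_power)
        ultimately show ?thesis using dilog_distribution(2)[of "-1" 2 "of_real y"] by simp
      qed
      then have "Re (dilog (of_real y)) + Re (dilog (- of_real y)) = Re (dilog (of_real (y\<^sup>2))) / 2"
        by (simp add: numeral_2_eq_2)
      moreover have "Re (dilog (of_real (y\<^sup>2))) \<le> Re (dilog (of_real y))"
      proof -
        define G where "G = (\<lambda>t. Re (dilog (of_real t * 1)))"
        have "G (y\<^sup>2) \<le> G y"
        proof (rule DERIV_nonneg_imp_nondecreasing[where f = G])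
          show "y\<^sup>2 \<le> y" using elim(1) by (simp add: power2_eq_square)
          fix t assume t: "y\<^sup>2 \<le> t" "t \<le> y"
          then have t1: "0 < t" "t < 1" using elim(1) by (auto intro: less_le_trans[of 0 "y\<^sup>2"])
          have "(G has_real_derivative - ln (norm (1 - of_real t * 1 :: complex)) / t) (at t)"
            unfolding G_def using t1 by (intro has_real_derivative_dilog_ray) (auto simp: slit_plane_iff)
          moreover have "norm (1 - of_real t * 1 :: complex) = 1 - t"
            using t1 by (metis abs_of_pos diff_gt_0_iff_gt mult.right_neutral norm_of_real of_real_1 of_real_diff)
          moreover have "- ln (1 - t) / t \<ge> 0" using t1 by (intro divide_nonneg_pos) simp_all
          ultimately show "\<exists>D. (G has_real_derivative D) (at t) \<and> 0 \<le> D" by auto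
        qed
        then show ?thesis by (simp add: G_def)
      qed
      ultimately show ?case using elim(2) e by (simp add: field_simps)
    qed
  qed
  ultimately show "Re (dilog (-1)) \<le> - (pi\<^sup>2 / 12) + e"
    by (intro tendsto_upperbound[of _ _ "at_left (1::real)"]) auto
qed

subsection \<open>Radial asymptotics of Pochhammer products\<close>

lemma abs_ln_diff_le:
  fixes p q d :: real
  assumes "d > 0" "d \<le> p" "d \<le> q"
  shows "\<bar>ln p - ln q\<bar> \<le> \<bar>p - q\<bar> / d"
proof -
  have *: "ln p - ln q \<le> \<bar>p - q\<bar> / d" if "d \<le> p" "d \<le> q" for p q
  proof -
    have "ln p - ln q = ln (p / q)" using that assms(1) by (simp add: ln_div)
    also have "\<dots> \<le> p / q - 1" using that assms(1) by (intro ln_le_minus_one) simp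
    also have "\<dots> = (p - q) / q" using that assms(1) by (simp add: diff_divide_distrib)
    also have "\<dots> \<le> \<bar>p - q\<bar> / q" using that assms(1) by (intro divide_right_mono) auto
    also have "\<dots> \<le> \<bar>p - q\<bar> / d" using that assms(1) by (intro divide_left_mono) auto
    finally show ?thesis .
  qed
  show ?thesis using *[of p q] *[of q p] assms by (auto simp: abs_le_iff abs_minus_commute)
qed

text \<open>A Riemann sum of mesh h for u -> ln |1 - exp(-u) z|, whose antiderivative is Re
  Li_2(exp(-u) z). The integrand is Lipschitz in exp(-u) with constant |z|/d, where d is the minimum
  of |1 - t z| on [0,1], so its oscillations over the cells telescope to at most |z|/d. The error is
  thus uniform in the number of cells, which may tend to infinity, and in the offset a, which varies
  with the residue class.\<close>

lemma dilog_riemann_sum: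
  assumes z: "z \<in> slit_plane"
  shows "\<exists>C. \<forall>h>0. \<forall>a. 0 \<le> a \<longrightarrow> a \<le> h \<longrightarrow> (\<forall>J.
    \<bar>h * (\<Sum>j<J. ln (norm (1 - of_real (exp (- (h * real j + a))) * z)))
      - (Re (dilog (of_real (exp (- (h * real J))) * z)) - Re (dilog z))\<bar> \<le> C * h)"
proof -
  have "continuous_on {0..1} (\<lambda>t. norm (1 - of_real t * z))" by (intro continuous_intros)
  then obtain t0 where t0: "t0 \<in> {0..1}" "\<And>t. t \<in> {0..1} \<Longrightarrow> norm (1 - of_real t0 * z) \<le> norm (1 - of_real t * z)"
    using continuous_attains_inf[of "{0..1::real}" "\<lambda>t. norm (1 - of_real t * z)"] by auto
  define d where "d = norm (1 - of_real t0 * z)"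
  have d0: "d > 0"
    using scale_slit_plane[OF z, of t0] t0(1) by (auto simp: d_def slit_plane_def)
  define f where "f = (\<lambda>u. ln (norm (1 - of_real (exp (- u)) * z)))"
  define G where "G = (\<lambda>u. Re (dilog (of_real (exp (- u)) * z)))"
  have lip: "\<bar>f u - f v\<bar> \<le> norm z / d * (exp (- l) - exp (- m))"
    if "0 \<le> l" "l \<le> u" "l \<le> v" "u \<le> m" "v \<le> m" for l m u v
  proof -
    have "\<bar>f u - f v\<bar> \<le> \<bar>norm (1 - of_real (exp (- u)) * z) - norm (1 - of_real (exp (- v)) * z)\<bar> / d"
      unfolding f_def using that d0 by (intro abs_ln_diff_le) (auto simp: d_def intro!: t0(2))
    also have "\<dots> \<le> norm ((1 - of_real (exp (- u)) * z) - (1 - of_real (exp (- v)) * z)) / d"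
      using d0 by (intro divide_right_mono norm_triangle_ineq3) auto
    also have "(1 - of_real (exp (- u)) * z) - (1 - of_real (exp (- v)) * z) = of_real (exp (- v) - exp (- u)) * z"
      by (simp add: algebra_simps)
    also have "norm \<dots> = \<bar>exp (- v) - exp (- u)\<bar> * norm z" by (simp only: norm_mult norm_of_real)
    also have "\<dots> / d \<le> (exp (- l) - exp (- m)) * norm z / d"
    proof -
      have "exp (- m) \<le> exp (- u)" "exp (- m) \<le> exp (- v)" "exp (- u) \<le> exp (- l)" "exp (- v) \<le> exp (- l)"
        using that by simp_all
      then have "\<bar>exp (- v) - exp (- u)\<bar> \<le> exp (- l) - exp (- m)" by linarith
      then show ?thesis using d0 by (intro divide_right_mono mult_right_mono) auto
    qed
    finally show ?thesis by (simp add: mult_ac)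
  qed
  have G: "(G has_real_derivative f u) (at u)" if "0 \<le> u" for u
  proof -
    have "((\<lambda>t. Re (dilog (of_real t * z))) has_real_derivative
        - ln (norm (1 - of_real (exp (- u)) * z)) / exp (- u)) (at (exp (- u)))"
      using that by (intro has_real_derivative_dilog_ray scale_slit_plane z) auto
    moreover have "((\<lambda>u. exp (- u)) has_real_derivative - exp (- u)) (at u)"
      by (auto intro!: derivative_eq_intros)
    ultimately have "(G has_real_derivative - ln (norm (1 - of_real (exp (- u)) * z)) / exp (- u) * - exp (- u)) (at u)"
      unfolding G_def by (rule DERIV_chain2)
    then show ?thesis by (simp add: f_def)
  qed
  have step: "\<bar>h * f (h * real j + a) - (G (h * real (Suc j)) - G (h * real j))\<bar>
      \<le> h * (norm z / d * (exp (- (h * real j)) - exp (- (h * real (Suc j)))))"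
    if h: "h > 0" "0 \<le> a" "a \<le> h" for h a j
  proof -
    have lt: "h * real j < h * real (Suc j)" using h by simp
    obtain \<xi> where \<xi>: "h * real j < \<xi>" "\<xi> < h * real (Suc j)"
      "G (h * real (Suc j)) - G (h * real j) = (h * real (Suc j) - h * real j) * f \<xi>"
      using MVT2[OF lt, of G f] G h by (metis mult_nonneg_nonneg of_nat_0_le_iff order_trans less_imp_le)
    have "h * f (h * real j + a) - (G (h * real (Suc j)) - G (h * real j)) = h * (f (h * real j + a) - f \<xi>)"
      unfolding \<xi>(3) by (simp add: algebra_simps)
    moreover have "\<bar>f (h * real j + a) - f \<xi>\<bar> \<le> norm z / d * (exp (- (h * real j)) - exp (- (h * real (Suc j))))"
      using \<xi> h by (intro lip) (auto simp: algebra_simps)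
    ultimately show ?thesis using h by (simp only: abs_mult abs_of_pos) (intro mult_left_mono, auto)
  qed
  show ?thesis
  proof (intro exI[of _ "norm z / d"] allI impI)
    fix h a :: real and J assume h: "h > 0" "0 \<le> a" "a \<le> h"
    have "h * (\<Sum>j<J. f (h * real j + a)) - (G (h * real J) - G 0)
        = (\<Sum>j<J. h * f (h * real j + a) - (G (h * real (Suc j)) - G (h * real j)))"
      using sum_lessThan_telescope[of "\<lambda>j. G (h * real j)" J]
      by (simp add: sum_subtractf sum_distrib_left del: of_nat_Suc)
    also have "\<bar>\<dots>\<bar> \<le> (\<Sum>j<J. h * (norm z / d * (exp (- (h * real j)) - exp (- (h * real (Suc j))))))"
      by (rule order_trans[OF sum_abs]) (intro sum_mono step h)
    also have "\<dots> = h * (norm z / d * (\<Sum>j<J. exp (- (h * real j)) - exp (- (h * real (Suc j)))))"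
      by (simp only: sum_distrib_left)
    also have "\<dots> = h * (norm z / d * (1 - exp (- (h * real J))))"
      using sum_lessThan_telescope'[of "\<lambda>j. exp (- (h * real j))" J] by simp
    also have "\<dots> \<le> h * (norm z / d * 1)"
      using h d0 by (intro mult_left_mono) auto
    finally show "\<bar>h * (\<Sum>j<J. ln (norm (1 - of_real (exp (- (h * real j + a))) * z)))
      - (Re (dilog (of_real (exp (- (h * real J))) * z)) - Re (dilog z))\<bar> \<le> norm z / d * h"
      by (simp add: f_def G_def mult_ac)
  qed
qed

text \<open>Grouping by residues modulo N: when q is a scaled N-th root of unity, each inner sum
  runs along a single ray.\<close>

lemma ln_norm_qpoch_blocks:
  assumes "\<And>m. a * q ^ m \<noteq> 1"
  shows "ln (norm (qpoch a q (N * J))) = (\<Sum>i<N. \<Sum>j<J. ln (norm (1 - a * q ^ (N * j + i))))"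
proof (induction J)
  case 0 show ?case by (simp add: qpoch_def)
next
  case (Suc J)
  have nz: "1 - a * q ^ m \<noteq> 0" for m using assms[of m] by (metis eq_iff_diff_eq_0)
  have "norm (qpoch (a * q ^ (N * J)) q N) = (\<Prod>i<N. norm (1 - a * q ^ (N * J + i)))"
    by (simp add: qpoch_def prod_norm[symmetric] power_add mult.assoc)
  then have "ln (norm (qpoch (a * q ^ (N * J)) q N)) = (\<Sum>i<N. ln (norm (1 - a * q ^ (N * J + i))))"
    using ln_prod[of "{..<N}" "\<lambda>i. norm (1 - a * q ^ (N * J + i))"] nz by simp
  moreover have "N * Suc J = N * J + N" by simp
  have "ln (norm (qpoch a q (N * Suc J))) = ln (norm (qpoch a q (N * J))) + ln (norm (qpoch (a * q ^ (N * J)) q N))"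
  proof -
    have "qpoch a q (N * J) \<noteq> 0" by (rule qpoch_nonzero[OF assms])
    moreover have "qpoch (a * q ^ (N * J)) q N \<noteq> 0"
      by (rule qpoch_nonzero) (metis assms mult.assoc power_add)
    ultimately show ?thesis
      unfolding \<open>N * Suc J = N * J + N\<close> qpoch_add norm_mult by (intro ln_mult_pos) auto
  qed
  ultimately show ?case using Suc.IH by (simp add: sum.distrib)
qed

lemma slit_plane_scaled_ne_1:
  assumes "z \<in> slit_plane" "0 \<le> t" "t \<le> 1" shows "of_real t * z \<noteq> 1"
proof
  assume "of_real t * z = 1"
  then have "1 \<in> slit_plane" using scale_slit_plane[OF assms] by metis
  then show False by (simp add: slit_plane_iff)
qed

lemma dilog_ray_tendsto_0:
  assumes "h > 0"
  shows "(\<lambda>J. Re (dilog (of_real (exp (- (h * real J))) * z))) \<longlonglongrightarrow> 0"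
proof -
  have "(\<lambda>J. exp (- (h * real J))) \<longlonglongrightarrow> 0" using assms by real_asymp
  then have "(\<lambda>J. of_real (exp (- (h * real J))) * z) \<longlonglongrightarrow> of_real 0 * z"
    by (intro tendsto_intros)
  then have "(\<lambda>J. of_real (exp (- (h * real J))) * z) \<longlonglongrightarrow> 0" by (simp only: of_real_0 mult_zero_left)
  from isCont_tendsto_compose[OF isCont_dilog[OF zero_in_slit_plane] this]
  have "(\<lambda>J. dilog (of_real (exp (- (h * real J))) * z)) \<longlonglongrightarrow> dilog 0" .
  from tendsto_Re[OF this] show ?thesis by simp
qed

lemma ln_norm_qpoch_tendsto:
  assumes q: "norm q < 1" and nz: "\<And>j. a * q ^ j \<noteq> 1" and N: "N > 0"
  shows "(\<lambda>J. ln (norm (qpoch a q (N * J)))) \<longlonglongrightarrow> ln (norm (\<Prod>j. 1 - a * q ^ j))"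
proof -
  have "(\<lambda>J. qpoch a q (N * J)) \<longlonglongrightarrow> (\<Prod>j. 1 - a * q ^ j)"
    using LIMSEQ_subseq_LIMSEQ[OF qpoch_tendsto[OF q], of "\<lambda>J. N * J"] N
    by (simp add: comp_def strict_mono_def)
  then show ?thesis
    using qpoch_inf_nonzero[OF q nz] by (intro tendsto_ln tendsto_norm) auto
qed

context
  fixes w :: complex and N :: nat
  assumes inj: "inj_on (\<lambda>j. w ^ j) {..<N}" and w: "w ^ N = 1" and N: "N > 0"
begin

lemma norm_root: "norm w = 1"
  using w N by (metis norm_one norm_power norm_ge_zero power_eq_1_iff less_imp_neq)

lemma scaled_root_power:
  "of_real (exp (- a)) * y * (of_real (exp (- (h / real N))) * w) ^ (N * j + i)
    = of_real (exp (- (h * real j + (a + h * real i / real N)))) * (y * w ^ i)"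
proof -
  have "w ^ (N * j + i) = w ^ i" by (simp add: power_add power_mult w)
  moreover have "exp (- a) * exp (- (h / real N)) ^ (N * j + i) = exp (- (h * real j + (a + h * real i / real N)))"
    using N by (simp add: exp_of_nat_mult[symmetric] exp_add[symmetric] field_simps)
  then have "of_real (exp (- a)) * of_real (exp (- (h / real N))) ^ (N * j + i)
      = (of_real (exp (- (h * real j + (a + h * real i / real N)))) :: complex)"
    by (metis of_real_mult of_real_power)
  ultimately show ?thesis by (simp add: power_mult_distrib mult_ac)
qed

lemma norm_scaled_root: "h > 0 \<Longrightarrow> norm (of_real (exp (- (h / real N))) * w) < 1"
  using N by (simp add: norm_mult norm_root)

text \<open>Each residue class i contributes a Riemann sum on the ray through y w^i with limit -Re
  Li_2(y w^i). The distribution relation collapses these to a single value at y^N. The factor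
  exp(-a) allows products that do not start at a power of the base.\<close>

lemma qpoch_radial_asymp:
  assumes y: "y ^ N \<in> slit_plane"
  shows "\<exists>C. \<forall>h>0. \<forall>a. 0 \<le> a \<longrightarrow> a \<le> h / real N \<longrightarrow>
    \<bar>h * ln (norm (\<Prod>j. 1 - of_real (exp (- a)) * y * (of_real (exp (- (h / real N))) * w) ^ j))
      + Re (dilog (y ^ N)) / N\<bar> \<le> C * h"
proof -
  note slit = dilog_distribution(1)[OF inj w N y]
  obtain C where C: "\<And>i h a J. h > 0 \<Longrightarrow> 0 \<le> a \<Longrightarrow> a \<le> h \<Longrightarrow>
    \<bar>h * (\<Sum>j<J. ln (norm (1 - of_real (exp (- (h * real j + a))) * (y * w ^ i))))
      - (Re (dilog (of_real (exp (- (h * real J))) * (y * w ^ i))) - Re (dilog (y * w ^ i)))\<bar> \<le> C i * h"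
    using dilog_riemann_sum[OF slit] by metis
  show ?thesis
  proof (intro exI[of _ "\<Sum>i<N. C i"] allI impI)
    fix h a :: real assume h: "h > 0" and a: "0 \<le> a" "a \<le> h / real N"
    define s where "s = of_real (exp (- (h / real N))) * w"
    define b where "b = of_real (exp (- a)) * y"
    have nz: "b * s ^ m \<noteq> 1" for m
    proof -
      have "0 \<le> h * real (m div N) + (a + h * real (m mod N) / real N)"
        using h a by (intro add_nonneg_nonneg mult_nonneg_nonneg divide_nonneg_nonneg) auto
      then have "b * s ^ (N * (m div N) + m mod N) \<noteq> 1"
        unfolding s_def b_def scaled_root_power by (intro slit_plane_scaled_ne_1 slit) auto
      then show ?thesis by simp
    qed
    define D where "D = (\<lambda>J. \<Sum>i<N. Re (dilog (of_real (exp (- (h * real J))) * (y * w ^ i))))"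
    have "\<bar>h * ln (norm (qpoch b s (N * J))) - (D J - Re (dilog (y ^ N)) / N)\<bar> \<le> (\<Sum>i<N. C i) * h" for J
    proof -
      have "h * ln (norm (qpoch b s (N * J))) - (D J - Re (dilog (y ^ N)) / N)
        = (\<Sum>i<N. h * (\<Sum>j<J. ln (norm (1 - of_real (exp (- (h * real j + (a + h * real i / real N)))) * (y * w ^ i))))
          - (Re (dilog (of_real (exp (- (h * real J))) * (y * w ^ i))) - Re (dilog (y * w ^ i))))"
        unfolding ln_norm_qpoch_blocks[OF nz] dilog_distribution(2)[OF inj w N y, symmetric] D_def
        unfolding b_def s_def scaled_root_power
        by (simp add: sum_subtractf sum_distrib_left)
      also have "\<bar>\<dots>\<bar> \<le> (\<Sum>i<N. C i * h)"
      proof (rule order_trans[OF sum_abs], intro sum_mono C h)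
        fix i assume i: "i \<in> {..<N}"
        show "0 \<le> a + h * real i / real N" using a h by simp
        \<comment> \<open>As i is at most N - 1, the offset within a cell leaves exactly h/N for
          a.\<close>
        have "a + h * real i / real N \<le> h / real N + h * (real N - 1) / real N"
          using a h i N by (intro add_mono divide_right_mono mult_left_mono) auto
        also have "\<dots> = h" using N by (simp add: field_simps)
        finally show "a + h * real i / real N \<le> h" .
      qed
      finally show ?thesis by (simp add: sum_distrib_right)
    qed
    moreover have "D \<longlonglongrightarrow> (\<Sum>i<N. 0)" unfolding D_def by (intro tendsto_sum dilog_ray_tendsto_0 h)
    then have "(\<lambda>J. \<bar>h * ln (norm (qpoch b s (N * J))) - (D J - Re (dilog (y ^ N)) / N)\<bar>)
        \<longlonglongrightarrow> \<bar>h * ln (norm (\<Prod>j. 1 - b * s ^ j)) - ((\<Sum>i<N. 0) - Re (dilog (y ^ N)) / N)\<bar>"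
      using norm_scaled_root[OF h] by (intro tendsto_intros ln_norm_qpoch_tendsto nz N) (auto simp: s_def)
    ultimately show "\<bar>h * ln (norm (\<Prod>j. 1 - b * s ^ j)) + Re (dilog (y ^ N)) / N\<bar> \<le> (\<Sum>i<N. C i) * h"
      by (auto intro: LIMSEQ_le_const2)
  qed
qed

lemma root_in_slit_plane:
  assumes "i < N - 1" shows "w ^ Suc i \<in> slit_plane"
proof (rule ccontr)
  assume "w ^ Suc i \<notin> slit_plane"
  then have im: "Im (w ^ Suc i) = 0" and re: "Re (w ^ Suc i) \<ge> 1" by (auto simp only: slit_plane_iff)
  have "norm (w ^ Suc i) = 1" by (simp only: norm_power norm_root power_one)
  then have "Re (w ^ Suc i) \<le> 1" by (metis complex_Re_le_cmod)
  with im re have "w ^ Suc i = w ^ 0" by (simp only: complex_eq_iff power_0 one_complex.sel) simp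
  then have "Suc i = 0" using assms by (intro inj_onD[OF inj]) auto
  then show False by simp
qed

lemma euler_product_perturbation:
  assumes "\<epsilon> > 0"
  shows "\<exists>\<rho>. 0 < \<rho> \<and> \<rho> < 1 \<and>
    (\<Sum>i<N - 1. Re (dilog (w ^ Suc i))) + Re (dilog (of_real \<rho>)) > pi\<^sup>2 / 6 / N - \<epsilon>"
proof -
  define F where "F = (\<lambda>\<rho>::real. \<Sum>i<N - 1. Re (dilog (w ^ Suc i)) - Re (dilog (of_real \<rho> * w ^ Suc i)))"
  have "isCont F 1"
  proof -
    have "isCont (\<lambda>\<rho>::real. Re (dilog (of_real \<rho> * w ^ Suc i))) 1" if "i < N - 1" for i
    proof -
      have "isCont dilog (of_real 1 * w ^ Suc i)" using isCont_dilog[OF root_in_slit_plane[OF that]] by simp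
      then have "isCont (\<lambda>\<rho>. dilog (of_real \<rho> * w ^ Suc i)) (1::real)"
        by (rule isCont_o2[where g = dilog, rotated]) (intro continuous_intros)
      then show ?thesis by (rule isCont_Re)
    qed
    then show ?thesis unfolding F_def by (intro continuous_intros) auto
  qed
  then have "(F \<longlongrightarrow> F 1) (at_left 1)" by (simp add: isCont_def filterlim_at_split)
  then have "(F \<longlongrightarrow> 0) (at_left 1)" by (simp add: F_def)
  then have 1: "\<forall>\<^sub>F \<rho> in at_left 1. F \<rho> > - (\<epsilon> / 2)" using assms by (intro order_tendstoD) auto
  have "filterlim (\<lambda>\<rho>::real. \<rho> ^ N) (at_left 1) (at_left 1)"
    unfolding filterlim_at
  proof
    have "((\<lambda>\<rho>::real. \<rho> ^ N) \<longlongrightarrow> 1 ^ N) (at_left 1)" by (intro tendsto_intros)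
    then show "((\<lambda>\<rho>::real. \<rho> ^ N) \<longlongrightarrow> 1) (at_left 1)" by simp
    have "\<rho> ^ N < 1" if "\<rho> \<in> {0<..<1}" for \<rho> :: real
      using that N by (simp add: power_less_one_iff)
    then show "\<forall>\<^sub>F \<rho>::real in at_left 1. \<rho> ^ N \<in> {..<1} \<and> \<rho> ^ N \<noteq> 1"
      by (intro eventually_at_leftI[of 0]) fastforce+
  qed
  then have 2: "\<forall>\<^sub>F \<rho> in at_left 1. Re (dilog (of_real (\<rho> ^ N))) > pi\<^sup>2 / 6 - \<epsilon> / 2"
    using Re_dilog_near_1[of "\<epsilon> / 2"] assms by (auto dest: eventually_compose_filterlim)
  have 3: "\<forall>\<^sub>F \<rho> in at_left (1::real). 0 < \<rho> \<and> \<rho> < 1"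
    by (rule eventually_at_leftI[of 0]) auto
  obtain \<rho> where \<rho>: "F \<rho> > - (\<epsilon> / 2)" "Re (dilog (of_real (\<rho> ^ N))) > pi\<^sup>2 / 6 - \<epsilon> / 2" "0 < \<rho>" "\<rho> < 1"
    using eventually_happens[OF eventually_conj[OF 1 eventually_conj[OF 2 3]]]
    by (auto simp: trivial_limit_at_left_real)
  have rN: "(of_real \<rho> :: complex) ^ N \<in> slit_plane"
    using \<rho> N by (auto simp: slit_plane_iff power_less_one_iff simp flip: of_real_power)
  have "w ^ N = w * w ^ (N - 1)" using N by (metis power_minus_mult mult.commute)
  have "(\<Sum>i<N. Re (dilog (of_real \<rho> * w ^ i))) = (\<Sum>i<Suc (N - 1). Re (dilog (of_real \<rho> * w ^ i)))"
    using N by simp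
  also have "\<dots> = Re (dilog (of_real \<rho>)) + (\<Sum>i<N - 1. Re (dilog (of_real \<rho> * w ^ Suc i)))"
    by (subst sum.lessThan_Suc_shift) simp
  finally have "Re (dilog (of_real \<rho>)) + (\<Sum>i<N - 1. Re (dilog (of_real \<rho> * w ^ Suc i))) = Re (dilog (of_real (\<rho> ^ N))) / N"
    using dilog_distribution(2)[OF inj w N rN] by simp
  then have "(\<Sum>i<N - 1. Re (dilog (w ^ Suc i))) + Re (dilog (of_real \<rho>)) = Re (dilog (of_real (\<rho> ^ N))) / N + F \<rho>"
    by (simp add: F_def sum_subtractf)
  moreover have "Re (dilog (of_real (\<rho> ^ N))) / N > (pi\<^sup>2 / 6 - \<epsilon> / 2) / N"
    using \<rho>(2) N by (intro divide_strict_right_mono) auto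
  moreover have "(\<epsilon> / 2) / N \<le> \<epsilon> / 2" using N assms by (simp add: divide_le_eq)
  ultimately show ?thesis using \<rho> by (intro exI[of _ \<rho>]) (simp add: diff_divide_distrib)
qed

text \<open>The root \<open>1\<close> lies on the cut of the dilogarithm; there it is replaced by some \<open>\<rho> < 1\<close>, which
  only increases the factors.\<close>

lemma euler_product_radial_upper:
  assumes \<epsilon>: "\<epsilon> > 0"
  shows "\<exists>C. \<forall>h>0. h * ln (norm (\<Prod>j. 1 - of_real (exp (- (h / real N))) * w * (of_real (exp (- (h / real N))) * w) ^ j))
    \<le> \<epsilon> - pi\<^sup>2 / 6 / N + C * h"
proof -
  obtain \<rho> where \<rho>: "0 < \<rho>" "\<rho> < 1"
    "(\<Sum>i<N - 1. Re (dilog (w ^ Suc i))) + Re (dilog (of_real \<rho>)) > pi\<^sup>2 / 6 / N - \<epsilon>"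
    using euler_product_perturbation[OF \<epsilon>] by blast
  \<comment> \<open>The exponents start at 1, so residue i carries w^(i+1) and the root 1 sits at i
    = N - 1.\<close>
  define z where "z = (\<lambda>i. if i = N - 1 then of_real \<rho> else w ^ Suc i)"
  have zsum: "(\<Sum>i<N. Re (dilog (z i))) > pi\<^sup>2 / 6 / N - \<epsilon>"
  proof -
    have "(\<Sum>i<N. Re (dilog (z i))) = (\<Sum>i<Suc (N - 1). Re (dilog (z i)))" using N by simp
    also have "\<dots> = (\<Sum>i<N - 1. Re (dilog (w ^ Suc i))) + Re (dilog (of_real \<rho>))"
      by (simp add: z_def)
    finally show ?thesis using \<rho> by simp
  qed
  have slit: "z i \<in> slit_plane" if "i < N" for i
    using that \<rho> root_in_slit_plane[of i] by (auto simp: z_def slit_plane_iff)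
  have "\<exists>C. \<forall>i<N. \<forall>h>0. \<forall>a. 0 \<le> a \<longrightarrow> a \<le> h \<longrightarrow> (\<forall>J.
    \<bar>h * (\<Sum>j<J. ln (norm (1 - of_real (exp (- (h * real j + a))) * z i)))
      - (Re (dilog (of_real (exp (- (h * real J))) * z i)) - Re (dilog (z i)))\<bar> \<le> C i * h)"
    using dilog_riemann_sum[OF slit] by (intro choice) blast
  then obtain C where C: "\<And>i h a J. i < N \<Longrightarrow> h > 0 \<Longrightarrow> 0 \<le> a \<Longrightarrow> a \<le> h \<Longrightarrow>
    \<bar>h * (\<Sum>j<J. ln (norm (1 - of_real (exp (- (h * real j + a))) * z i)))
      - (Re (dilog (of_real (exp (- (h * real J))) * z i)) - Re (dilog (z i)))\<bar> \<le> C i * h"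
    by blast
  show ?thesis
  proof (intro exI[of _ "\<Sum>i<N. C i"] allI impI)
    fix h :: real assume h: "h > 0"
    define s where "s = of_real (exp (- (h / real N))) * w"
    have sn: "norm s < 1" using norm_scaled_root[OF h] by (simp add: s_def)
    have nz: "s * s ^ m \<noteq> 1" for m
      using power_ne_one[OF sn, of "Suc m"] by simp
    define D where "D = (\<lambda>J. \<Sum>i<N. Re (dilog (of_real (exp (- (h * real J))) * z i)))"
    have le: "h * ln (norm (qpoch s s (N * J))) \<le> D J - (\<Sum>i<N. Re (dilog (z i))) + (\<Sum>i<N. C i) * h" for J
    proof -
      have e: "s * s ^ (N * j + i) = of_real (exp (- (h * real j + h * real (Suc i) / real N))) * w ^ Suc i" for i j
        using scaled_root_power[of "h / real N" w h j i] N
        by (simp add: s_def add_divide_distrib algebra_simps)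
      have term_le: "ln (norm (1 - s * s ^ (N * j + i)))
          \<le> ln (norm (1 - of_real (exp (- (h * real j + h * real (Suc i) / real N))) * z i))" if "i < N" for i j
      proof (cases "i = N - 1")
        case False
        then show ?thesis unfolding e z_def by simp
      next
        case True
        define t where "t = exp (- (h * real j + h * real (Suc i) / real N))"
        have "h * real j + h * real (Suc i) / real N > 0"
          using h N by (intro add_nonneg_pos) auto
        then have t: "0 < t" "t < 1" by (auto simp: t_def)
        have t\<rho>: "t * \<rho> \<le> t" "t * \<rho> < 1" using t \<rho> by (auto intro: mult_left_le less_le_trans[of _ "1 * \<rho>"] mult_strict_right_mono)
        have "w ^ Suc i = 1" using True N w by simp
        then have "norm (1 - s * s ^ (N * j + i)) = norm (of_real (1 - t) :: complex)"
          unfolding e t_def[symmetric] by simp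
        moreover have "norm (1 - of_real t * z i) = norm (of_real (1 - t * \<rho>) :: complex)"
          using True by (simp add: z_def)
        ultimately show ?thesis
          unfolding t_def[symmetric] norm_of_real using t t\<rho> by simp
      qed
      have "h * ln (norm (qpoch s s (N * J))) = h * (\<Sum>i<N. \<Sum>j<J. ln (norm (1 - s * s ^ (N * j + i))))"
        unfolding ln_norm_qpoch_blocks[OF nz] ..
      also have "\<dots> \<le> h * (\<Sum>i<N. \<Sum>j<J. ln (norm (1 - of_real (exp (- (h * real j + h * real (Suc i) / real N))) * z i)))"
        using h by (intro mult_left_mono sum_mono term_le) auto
      also have "\<dots> = (\<Sum>i<N. h * (\<Sum>j<J. ln (norm (1 - of_real (exp (- (h * real j + h * real (Suc i) / real N))) * z i))))"
        by (simp only: sum_distrib_left)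
      also have "\<dots> \<le> (\<Sum>i<N. Re (dilog (of_real (exp (- (h * real J))) * z i)) - Re (dilog (z i)) + C i * h)"
      proof (intro sum_mono)
        fix i assume i: "i \<in> {..<N}"
        have "h * real (Suc i) / real N \<le> h * real N / real N"
          using h i by (intro divide_right_mono mult_left_mono) auto
        then have "h * real (Suc i) / real N \<le> h" using N by simp
        moreover have "0 \<le> h * real (Suc i) / real N" using h by simp
        ultimately show "h * (\<Sum>j<J. ln (norm (1 - of_real (exp (- (h * real j + h * real (Suc i) / real N))) * z i)))
          \<le> Re (dilog (of_real (exp (- (h * real J))) * z i)) - Re (dilog (z i)) + C i * h"
          using C[of i h "h * real (Suc i) / real N" J] i h unfolding abs_le_iff by auto
      qed
      also have "\<dots> = D J - (\<Sum>i<N. Re (dilog (z i))) + (\<Sum>i<N. C i) * h"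
        by (simp add: D_def sum.distrib sum_subtractf sum_distrib_right)
      finally show ?thesis .
    qed
    have "D \<longlonglongrightarrow> (\<Sum>i<N. 0)" unfolding D_def by (intro tendsto_sum dilog_ray_tendsto_0 h)
    then have "(\<lambda>J. D J - (\<Sum>i<N. Re (dilog (z i))) + (\<Sum>i<N. C i) * h)
        \<longlonglongrightarrow> (\<Sum>i<N. 0) - (\<Sum>i<N. Re (dilog (z i))) + (\<Sum>i<N. C i) * h"
      by (intro tendsto_intros)
    moreover have "(\<lambda>J. h * ln (norm (qpoch s s (N * J)))) \<longlonglongrightarrow> h * ln (norm (\<Prod>j. 1 - s * s ^ j))"
      by (intro tendsto_intros ln_norm_qpoch_tendsto sn nz N)
    ultimately have "h * ln (norm (\<Prod>j. 1 - s * s ^ j)) \<le> (\<Sum>i<N. 0) - (\<Sum>i<N. Re (dilog (z i))) + (\<Sum>i<N. C i) * h"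
      using le by (intro LIMSEQ_le[of _ _ "\<lambda>J. D J - (\<Sum>i<N. Re (dilog (z i))) + (\<Sum>i<N. C i) * h"]) auto
    then show "h * ln (norm (\<Prod>j. 1 - s * s ^ j)) \<le> \<epsilon> - pi\<^sup>2 / 6 / N + (\<Sum>i<N. C i) * h"
      using zsum by simp
  qed
qed

end

subsection \<open>The radial limit of the theta product\<close>

lemma theta_product_tendsto_0:
  fixes q b :: complex
  assumes N: "N > 0" and inj: "inj_on (\<lambda>j. (q ^ 4) ^ j) {..<N}" and q2N: "(q\<^sup>2) ^ N = -1"
    and c: "(b powi (-2)) ^ N \<in> slit_plane" "norm (1 - (b powi (-2)) ^ N) \<ge> 1"
  shows "((\<lambda>r. theta_product b (of_real r * q)) \<longlongrightarrow> 0) (at_left 1)"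
proof -
  define w x where "w = q ^ 4" and "x = b powi (-2)"
  have w4: "w = (q\<^sup>2)\<^sup>2" by (simp add: w_def flip: power_mult)
  have w: "w ^ N = 1" unfolding w4 using q2N by (metis power_mult mult.commute power2_minus power_one)
  have inj: "inj_on (\<lambda>j. w ^ j) {..<N}" using inj by (simp add: w_def)
  have nq: "norm q = 1"
    using power_eq_1_iff[of q "4 * N"] w N by (simp add: w_def power_mult)
  \<comment> \<open>The gap in the dilogarithm bound. Half of it is spent on the \<epsilon> of the
    Euler product; the other half gives the decay.\<close>
  define K where "K = (pi\<^sup>2 / 4 - Re (dilog (x ^ N))) / N"
  have K0: "K > 0" using Re_dilog_less[of "x ^ N"] c N by (simp add: K_def x_def)
  have xw: "(x * w) ^ N = x ^ N" by (simp add: power_mult_distrib w)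
  have sB: "(q\<^sup>2) ^ N \<in> slit_plane" by (simp add: q2N slit_plane_iff)
  have sC: "(x * w) ^ N \<in> slit_plane" unfolding xw unfolding x_def by (rule c(1))
  obtain CA where CA: "\<And>h. h > 0 \<Longrightarrow> h * ln (norm (\<Prod>j. 1 - of_real (exp (- (h / real N))) * w * (of_real (exp (- (h / real N))) * w) ^ j))
    \<le> K / 2 - pi\<^sup>2 / 6 / N + CA * h"
    using euler_product_radial_upper[OF inj w N, of "K / 2"] K0 by auto
  obtain CB where CB: "\<And>h a. h > 0 \<Longrightarrow> 0 \<le> a \<Longrightarrow> a \<le> h / real N \<Longrightarrow>
    \<bar>h * ln (norm (\<Prod>j. 1 - of_real (exp (- a)) * q\<^sup>2 * (of_real (exp (- (h / real N))) * w) ^ j))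
      + Re (dilog ((q\<^sup>2) ^ N)) / N\<bar> \<le> CB * h"
    using qpoch_radial_asymp[OF inj w N sB] by metis
  obtain CC where CC: "\<And>h a. h > 0 \<Longrightarrow> 0 \<le> a \<Longrightarrow> a \<le> h / real N \<Longrightarrow>
    \<bar>h * ln (norm (\<Prod>j. 1 - of_real (exp (- a)) * (x * w) * (of_real (exp (- (h / real N))) * w) ^ j))
      + Re (dilog ((x * w) ^ N)) / N\<bar> \<le> CC * h"
    using qpoch_radial_asymp[OF inj w N sC] by metis
  define C where "C = CA + CB + CC"
  have bound: "norm (theta_product b (of_real r * q)) \<le> exp (C + K / (8 * N) / ln r)" if r: "0 < r" "r < 1" for r
  proof -
    \<comment> \<open>Chosen so that r^4 = exp(-h/N). The product starting at (r q)^2 then has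
      offset a = h/(2N), the one starting at x (r q)^4 has a = h/N.\<close>
    define h where "h = - (4 * real N * ln r)"
    have h: "h > 0" using r N by (simp add: h_def mult_pos_neg)
    have r4: "r ^ 4 = exp (- (h / real N))" and r2: "r ^ 2 = exp (- (h / (2 * real N)))"
      using r N exp_of_nat_mult[of 4 "ln r"] exp_of_nat_mult[of 2 "ln r"] by (simp_all add: h_def)
    have q4: "(of_real r * q) ^ 4 = of_real (exp (- (h / real N))) * w"
      by (simp add: power_mult_distrib w_def flip: r4)
    have q2: "(of_real r * q)\<^sup>2 = of_real (exp (- (h / (2 * real N)))) * q\<^sup>2"
      by (simp add: power_mult_distrib flip: r2)
    have xq4: "x * (of_real r * q) ^ 4 = of_real (exp (- (h / real N))) * (x * w)"
      unfolding q4 by simp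
    have nrq: "norm (of_real r * q) < 1" using r by (simp add: norm_mult nq)
    have nz: "x * (of_real r * q) ^ (4 * m + 4) \<noteq> 1" for m
    proof -
      have "x * (of_real r * q) ^ (4 * m + 4) = of_real (r ^ (4 * m + 4)) * (x * q ^ (4 * m + 4))"
        by (simp only: power_mult_distrib of_real_power mult_ac)
      also have "x * q ^ (4 * m + 4) = x * w * w ^ m"
        by (simp only: power_add power_mult w_def) (simp only: mult_ac)
      also have "of_real (r ^ (4 * m + 4)) * (x * w * w ^ m) \<noteq> 1"
        using r by (intro slit_plane_scaled_ne_1 dilog_distribution(1)[OF inj w N sC]) (auto intro: power_le_one)
      finally show ?thesis .
    qed
    define A B D where "A = (\<Prod>j. 1 - (of_real r * q) ^ 4 * ((of_real r * q) ^ 4) ^ j)"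
      and "B = (\<Prod>j. 1 - (of_real r * q)\<^sup>2 * ((of_real r * q) ^ 4) ^ j)"
      and "D = (\<Prod>j. 1 - x * (of_real r * q) ^ 4 * ((of_real r * q) ^ 4) ^ j)"
    have TP: "theta_product b (of_real r * q) = A / B / D"
      unfolding A_def B_def D_def x_def by (rule theta_product_eq[OF nrq nz[unfolded x_def]])
    show ?thesis
    \<comment> \<open>At a zero the bound is trivial, while \<open>ln\<close> of the modulus would
      carry no information.\<close>
    proof (cases "theta_product b (of_real r * q) = 0")
      case False
      then have ne: "A \<noteq> 0" "B \<noteq> 0" "D \<noteq> 0" by (auto simp: TP)
      have "h * ln (norm A) \<le> K / 2 - pi\<^sup>2 / 6 / N + CA * h"
        using CA[OF h] unfolding A_def q4 .
      moreover have "\<bar>h * ln (norm B) + Re (dilog (-1)) / N\<bar> \<le> CB * h"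
        using CB[OF h, of "h / (2 * real N)"] h N unfolding B_def q4 q2 q2N
        by (auto simp: field_simps)
      moreover have "\<bar>h * ln (norm D) + Re (dilog (x ^ N)) / N\<bar> \<le> CC * h"
        using CC[OF h, of "h / real N"] h N unfolding D_def xq4 xw unfolding q4 by auto
      \<comment> \<open>The unit of account: the Euler product gives 2P, the product in q^2 gives P,
        together the pi^2/4 in K.\<close>
      moreover define P where "P = pi\<^sup>2 / 12 / N"
      moreover have "Re (dilog (-1)) / N \<le> - P"
        using divide_right_mono[OF Re_dilog_minus_1, of "real N"] by (simp add: P_def)
      moreover have "pi\<^sup>2 / 6 / N = 2 * P" by (simp add: P_def)
      moreover have "K = 3 * P - Re (dilog (x ^ N)) / N"
        by (simp add: K_def P_def diff_divide_distrib)
      ultimately have "h * ln (norm A) - h * ln (norm B) - h * ln (norm D) \<le> - K / 2 + C * h"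
        unfolding C_def distrib_right by linarith
      moreover have "ln (norm (A / B / D)) = ln (norm A) - ln (norm B) - ln (norm D)"
        using ne by (simp add: norm_divide norm_mult ln_div ln_mult)
      ultimately have "h * ln (norm (A / B / D)) \<le> - K / 2 + C * h"
        by (simp only: right_diff_distrib)
      then have "ln (norm (A / B / D)) \<le> C - K / 2 / h"
        using h by (simp add: field_simps)
      moreover have "C - K / 2 / h = C + K / (8 * N) / ln r"
        using r N by (simp add: h_def field_simps)
      ultimately have "exp (ln (norm (A / B / D))) \<le> exp (C + K / (8 * N) / ln r)"
        unfolding exp_le_cancel_iff by linarith
      moreover have "exp (ln (norm (A / B / D))) = norm (A / B / D)"
        using ne by simp
      ultimately show ?thesis unfolding TP by (simp only:)
    qed simp
  qed
  have "((\<lambda>r. exp (C + K / (8 * N) / ln r)) \<longlongrightarrow> 0) (at_left 1)"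
  proof -
    define k where "k = K / (8 * N)"
    have "k > 0" using K0 N by (simp add: k_def)
    then have "((\<lambda>r. exp (C + k / ln r)) \<longlongrightarrow> 0) (at_left 1)" by real_asymp
    then show ?thesis by (simp add: k_def)
  qed
  moreover have "\<forall>\<^sub>F r in at_left 1. norm (theta_product b (of_real r * q)) \<le> exp (C + K / (8 * N) / ln r)"
  proof (rule eventually_at_leftI[of 0])
    fix r :: real assume "r \<in> {0<..<1}"
    then show "norm (theta_product b (of_real r * q)) \<le> exp (C + K / (8 * N) / ln r)"
      by (intro bound) auto
  qed simp
  ultimately show ?thesis by (rule Lim_null_comparison[rotated])
qed

section \<open>Unboundedness along a radius that carries poles\<close>

lemma norm_prod_one_minus_le:
  fixes f :: "nat \<Rightarrow> complex"
  assumes "finite S" "\<And>j. norm (f j) \<le> A * R ^ j" "0 \<le> A" "0 \<le> R" "R < 1"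
  shows "norm (\<Prod>j\<in>S. 1 - f j) \<le> exp (A / (1 - R))"
proof -
  have "norm (\<Prod>j\<in>S. 1 - f j) \<le> (\<Prod>j\<in>S. exp (A * R ^ j))"
    unfolding prod_norm[symmetric]
  proof (intro prod_mono conjI norm_ge_zero)
    fix j
    have "norm (1 - f j) \<le> 1 + norm (f j)" by (metis norm_one norm_triangle_ineq4)
    also have "\<dots> \<le> 1 + A * R ^ j" using assms(2) by simp
    also have "\<dots> \<le> exp (A * R ^ j)" by (rule exp_ge_add_one_self)
    finally show "norm (1 - f j) \<le> exp (A * R ^ j)" .
  qed
  also have "\<dots> = exp (A * (\<Sum>j\<in>S. R ^ j))"
    using assms(1) by (simp add: exp_sum sum_distrib_left)
  also have "\<dots> \<le> exp (A * (1 / (1 - R)))"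
  proof -
    have "(\<Sum>j\<in>S. R ^ j) \<le> (\<Sum>j. R ^ j)"
      using assms by (intro sum_le_suminf summable_geometric) auto
    also have "\<dots> = 1 / (1 - R)" using assms by (intro suminf_geometric) auto
    finally have "A * (\<Sum>j\<in>S. R ^ j) \<le> A * (1 / (1 - R))" using assms by (intro mult_left_mono) auto
    then show ?thesis by (simp only: exp_le_cancel_iff)
  qed
  finally show ?thesis by simp
qed

text \<open>Each factor is at least 1 - t with t = A R^j <= A < 1, and 1 - t >= exp(-t/(1 - A)); the
  exponents sum to a geometric series.\<close>

lemma norm_prod_one_minus_ge:
  fixes f :: "nat \<Rightarrow> complex"
  assumes "finite S" "\<And>j. norm (f j) \<le> A * R ^ j" "0 \<le> A" "A < 1" "0 \<le> R" "R < 1"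
  shows "norm (\<Prod>j\<in>S. 1 - f j) \<ge> exp (- (A / (1 - A) / (1 - R)))"
proof -
  have "exp (- (A / (1 - A) / (1 - R))) \<le> exp (- (A / (1 - A) * (\<Sum>j\<in>S. R ^ j)))"
  proof -
    have "(\<Sum>j\<in>S. R ^ j) \<le> (\<Sum>j. R ^ j)"
      using assms by (intro sum_le_suminf summable_geometric) auto
    also have "\<dots> = 1 / (1 - R)" using assms by (intro suminf_geometric) auto
    finally have "A / (1 - A) * (\<Sum>j\<in>S. R ^ j) \<le> A / (1 - A) * (1 / (1 - R))"
      using assms by (intro mult_left_mono) auto
    then show ?thesis by simp
  qed
  also have "\<dots> = (\<Prod>j\<in>S. exp (- (A / (1 - A) * R ^ j)))"
    using assms(1) by (simp add: exp_sum sum_distrib_left sum_negf[symmetric] del: sum_negf)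
  also have "\<dots> \<le> norm (\<Prod>j\<in>S. 1 - f j)"
    unfolding prod_norm[symmetric]
  proof (intro prod_mono conjI)
    fix j
    define t where "t = A * R ^ j"
    have "R ^ j \<le> 1" using assms by (intro power_le_one) auto
    then have "t \<le> A" using assms unfolding t_def by (intro mult_left_le) auto
    have t: "0 \<le> t" "t < 1" using assms \<open>t \<le> A\<close> by (auto simp: t_def)
    have "1 / (1 - t) = 1 + t / (1 - t)" using t by (simp add: field_simps)
    also have "\<dots> \<le> exp (t / (1 - t))" by (rule exp_ge_add_one_self)
    also have "\<dots> \<le> exp (t / (1 - A))"
      using t \<open>t \<le> A\<close> assms by (simp add: divide_left_mono)
    finally have "1 / (1 - t) \<le> exp (t / (1 - A))" .
    then have "exp (- (t / (1 - A))) \<le> 1 - t"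
      using t by (simp add: exp_minus field_simps)
    also have "\<dots> \<le> 1 - norm (f j)" using assms(2)[of j] by (simp add: t_def)
    also have "\<dots> \<le> norm (1 - f j)" by (metis norm_one norm_triangle_ineq2)
    finally show "exp (- (A / (1 - A) * R ^ j)) \<le> norm (1 - f j)" by (simp add: t_def)
  qed simp
  finally show ?thesis .
qed

text \<open>Poles accumulate on the radius here, so the function is unbounded near its end point.\<close>

lemma theta_product_not_convergent:
  fixes q b :: complex
  assumes N: "N > 0" and inj: "inj_on (\<lambda>j. (q ^ 4) ^ j) {..<N}" and q4N: "(q ^ 4) ^ N = 1"
    and c: "(b powi (-2)) ^ N = of_real c" "c > 1"
  shows "\<not> ((\<lambda>r. theta_product b (of_real r * q)) \<longlongrightarrow> L) (at_left 1)"
proof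
  assume lim: "((\<lambda>r. theta_product b (of_real r * q)) \<longlongrightarrow> L) (at_left 1)"
  define w x y where "w = q ^ 4" and "x = b powi (-2)" and "y = root N c"
  have w: "w ^ N = 1" and inj: "inj_on (\<lambda>j. w ^ j) {..<N}" using q4N inj by (simp_all add: w_def)
  have y: "y > 1" "y ^ N = c" using c(2) N by (auto simp: y_def)
  have qn: "norm q = 1"
    using power_eq_1_iff[of q "4 * N"] w N by (simp add: w_def power_mult)
  have xn: "norm x = y"
  proof -
    have "norm x ^ N = y ^ N" using c y by (simp add: x_def flip: norm_power)
    then show ?thesis using y N by (metis norm_ge_zero power_eq_imp_eq_base less_imp_le zero_less_one less_trans)
  qed
  \<comment> \<open>The quotient x/y is an N-th root of unity, and the powers of w exhaust these by
    counting.\<close>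
  obtain m where m: "m < N" "x = of_real y * w ^ m"
  proof -
    have "(\<lambda>j. w ^ j) ` {..<N} = {z. z ^ N = 1}"
    proof (rule card_subset_eq)
      show "finite {z::complex. z ^ N = 1}" using N by (intro finite_roots_unity) auto
      show "(\<lambda>j. w ^ j) ` {..<N} \<subseteq> {z. z ^ N = 1}"
      proof (clarsimp)
        fix j show "(w ^ j) ^ N = 1" using w by (metis power_mult mult.commute power_one)
      qed
      show "card ((\<lambda>j. w ^ j) ` {..<N}) = card {z::complex. z ^ N = 1}"
        using N inj by (simp add: card_image card_roots_unity_eq)
    qed
    moreover have "(x / of_real y) ^ N = 1"
      using c y by (simp add: power_divide x_def flip: of_real_power)
    ultimately obtain m where "m < N" "x / of_real y = w ^ m" by (metis (mono_tags, lifting) imageE lessThan_iff mem_Collect_eq)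
    then show thesis using y by (intro that[of m]) (auto simp: field_simps)
  qed
  obtain \<epsilon> where \<epsilon>: "\<epsilon> < 1" "\<And>r. \<epsilon> < r \<Longrightarrow> r < 1 \<Longrightarrow> norm (theta_product b (of_real r * q)) < norm L + 1"
  proof -
    have "\<forall>\<^sub>F r in at_left 1. norm (theta_product b (of_real r * q)) < norm L + 1"
      using tendsto_norm[OF lim] by (intro order_tendstoD(2)) auto
    then show thesis using that by (auto simp: eventually_at_left_field)
  qed
  \<comment> \<open>The radius r with y r^(4 \<mu>) = 1. Integers \<mu> in the right residue class
    give poles; real \<mu> allows approaching a pole, at which the value itself is 0 by
    convention.\<close>
  define \<rho> where "\<rho> = (\<lambda>\<mu>::real. exp (- ln y / (4 * \<mu>)))"
  have "(\<lambda>j. \<rho> (real (N * j + (N - m)))) \<longlonglongrightarrow> 1"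
  proof -
    have "filterlim (\<lambda>j. real (N * j + (N - m))) at_top sequentially"
      using N by (intro filterlim_compose[OF filterlim_real_sequentially] filterlim_subseq) (auto simp: strict_mono_def)
    moreover have "(\<rho> \<longlongrightarrow> 1) at_top" unfolding \<rho>_def using y by real_asymp
    ultimately show ?thesis by (rule filterlim_compose[rotated])
  qed
  then have "\<forall>\<^sub>F j in sequentially. \<rho> (real (N * j + (N - m))) > \<epsilon>"
    using \<epsilon>(1) by (intro order_tendstoD) auto
  then obtain j where j: "\<rho> (real (N * j + (N - m))) > \<epsilon>" by (auto simp: eventually_at_top_linorder)
  \<comment> \<open>Since m + e is a multiple of N, x w^e is the positive number y, so a pole sits
    on the radius at \<open>\<rho> e\<close>; j is large enough to place it beyond
    \<epsilon>.\<close>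
  define e where "e = N * j + (N - m)"
  have e0: "e > 0" using m by (simp add: e_def)
  have we: "x * w ^ e = of_real y"
  proof -
    have "w ^ m * w ^ e = w ^ (m + e)" by (simp add: power_add)
    also have "m + e = N * Suc j" using m by (simp add: e_def)
    also have "w ^ (N * Suc j) = 1" by (simp only: power_mult w power_one)
    finally show ?thesis unfolding m(2) by (simp add: mult.assoc)
  qed
  define R where "R = \<rho> (real e + 1) ^ 4"
  have R: "0 < R" "R < 1"
    using y by (auto simp: R_def \<rho>_def power_less_one_iff field_simps)
  define K where "K = exp (- (R / (1 - R) / (1 - R)))"
  define K' where "K' = (norm L + 1) * exp (1 / (1 - R)) * exp (y / (1 - R))"
  \<comment> \<open>Between two consecutive integers no denominator factor vanishes. There the
    numerator A stays above K, whereas A = (value) B D, and D contains a factor that tends to 0 at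
    the pole. K and K' do not depend on \<mu>, so \<mu> -> e gives the contradiction K <= 0.\<close>
  have ineq: "K \<le> K' * \<bar>1 - y * \<rho> \<mu> ^ (4 * e)\<bar>" if \<mu>: "real e < \<mu>" "\<mu> < real e + 1" for \<mu>
  proof -
    define r where "r = \<rho> \<mu>"
    have lny: "ln y > 0" using y by simp
    have mono: "\<rho> (real e) < r" "r < \<rho> (real e + 1)" "r < 1" "0 < r"
    proof -
      have "ln y / (4 * (real e + 1)) < ln y / (4 * \<mu>)" "ln y / (4 * \<mu>) < ln y / (4 * real e)" "0 < ln y / (4 * \<mu>)"
        using \<mu> lny e0 by (auto intro!: divide_strict_left_mono divide_pos_pos mult_pos_pos)
      then show "\<rho> (real e) < r" "r < \<rho> (real e + 1)" "r < 1" "0 < r"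
        unfolding r_def \<rho>_def by simp_all
    qed
    have re: "\<epsilon> < r" using j mono(1) by (simp add: e_def)
    define t where "t = (of_real r * q) ^ 4"
    have tn: "norm t = r ^ 4" using mono by (simp add: t_def norm_mult norm_power qn)
    have tR: "r ^ 4 \<le> R" unfolding R_def using mono by (intro power_mono) auto
    have nrq: "norm (of_real r * q) < 1" using mono by (simp add: norm_mult qn)
    have tw: "t = of_real (r ^ 4) * w" by (simp add: t_def w_def power_mult_distrib)
    have nz: "b powi (-2) * (of_real r * q) ^ (4 * n + 4) \<noteq> 1" for n
    proof
      assume "b powi (-2) * (of_real r * q) ^ (4 * n + 4) = 1"
      then have "norm (x * (of_real r * q) ^ (4 * n + 4)) = 1" by (simp add: x_def)
      then have "y * r ^ (4 * n + 4) = 1" using mono by (simp only: norm_mult norm_power xn qn norm_of_real) simp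
      then have "ln (y * r ^ (4 * n + 4)) = 0" by simp
      then have "ln y + real (4 * n + 4) * ln r = 0"
        using y mono by (subst (asm) ln_mult_pos) (auto simp: ln_realpow)
      then have "ln y * (\<mu> - real (n + 1)) = 0" using \<mu> e0 by (simp add: r_def \<rho>_def field_simps)
      then have "\<mu> = real (n + 1)" using lny by simp
      then show False using \<mu> by (metis Suc_eq_plus1 not_less_eq of_nat_Suc of_nat_less_iff add.commute)
    qed
    define A B D where "A = (\<Prod>j. 1 - t * t ^ j)"
      and "B = (\<Prod>j. 1 - (of_real r * q)\<^sup>2 * t ^ j)" and "D = (\<Prod>j. 1 - x * t * t ^ j)"
    have TP: "theta_product b (of_real r * q) = A / B / D"
      unfolding A_def B_def D_def x_def t_def by (rule theta_product_eq[OF nrq nz])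
    have t1: "norm t < 1" using tn tR R by simp
    have BD: "B \<noteq> 0" "D \<noteq> 0"
    proof -
      have "(of_real r * q)\<^sup>2 * t ^ j \<noteq> 1" for j
        using power_ne_one[OF nrq, of "2 + 4 * j"] by (simp only: t_def power_add power_mult) simp
      then show "B \<noteq> 0" unfolding B_def by (intro qpoch_inf_nonzero t1)
      have "x * t * t ^ j \<noteq> 1" for j
        using nz[of j] by (simp only: x_def t_def power_add power_mult) (simp add: mult_ac)
      then show "D \<noteq> 0" unfolding D_def by (intro qpoch_inf_nonzero t1)
    qed
    have tj: "norm (t ^ j) \<le> R ^ j" for j
      unfolding norm_power tn using tR mono by (intro power_mono) auto
    have A: "K \<le> norm A"
    proof (rule LIMSEQ_le_const)
      show "(\<lambda>n. norm (qpoch t t n)) \<longlonglongrightarrow> norm A" unfolding A_def by (intro tendsto_norm qpoch_tendsto t1)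
      have "K \<le> norm (qpoch t t n)" for n
        unfolding K_def qpoch_def
      proof (rule norm_prod_one_minus_ge)
        show "norm (t * t ^ j) \<le> R * R ^ j" for j
          unfolding norm_mult using tj[of 1] tj[of j] R by (intro mult_mono) auto
      qed (use R in auto)
      then show "\<exists>N. \<forall>n\<ge>N. K \<le> norm (qpoch t t n)" by blast
    qed
    have B: "norm B \<le> exp (1 / (1 - R))"
    proof (rule LIMSEQ_le_const2)
      show "(\<lambda>n. norm (qpoch ((of_real r * q)\<^sup>2) t n)) \<longlonglongrightarrow> norm B"
        unfolding B_def by (intro tendsto_norm qpoch_tendsto t1)
      have "norm (qpoch ((of_real r * q)\<^sup>2) t n) \<le> exp (1 / (1 - R))" for n
        unfolding qpoch_def
      proof (rule norm_prod_one_minus_le)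
        show "norm ((of_real r * q)\<^sup>2 * t ^ j) \<le> 1 * R ^ j" for j
        proof -
          have "norm ((of_real r * q)\<^sup>2) \<le> 1"
            unfolding norm_power using nrq by (intro power_le_one) auto
          then show ?thesis
            unfolding norm_mult[of "(of_real r * q)\<^sup>2"] using tj[of j] by (intro mult_mono) auto
        qed
      qed (use R in auto)
      then show "\<exists>N. \<forall>n\<ge>N. norm (qpoch ((of_real r * q)\<^sup>2) t n) \<le> exp (1 / (1 - R))" by blast
    qed
    have D: "norm D \<le> \<bar>1 - y * r ^ (4 * e)\<bar> * exp (y / (1 - R))"
    proof (rule LIMSEQ_le_const2)
      show "(\<lambda>n. norm (qpoch (x * t) t n)) \<longlonglongrightarrow> norm D"
        unfolding D_def by (intro tendsto_norm qpoch_tendsto t1)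
      have "norm (qpoch (x * t) t n) \<le> \<bar>1 - y * r ^ (4 * e)\<bar> * exp (y / (1 - R))" if "n \<ge> e" for n
      proof -
        \<comment> \<open>The vanishing factor has index e - 1, because the product starts with x
          t.\<close>
        have mem: "e - 1 \<in> {..<n}" using that e0 by auto
        have "x * t * t ^ (e - 1) = x * t ^ e" using e0 by (simp add: mult.assoc flip: power_Suc)
        also have "\<dots> = of_real (y * r ^ (4 * e))"
        proof -
          have "t ^ e = of_real (r ^ (4 * e)) * w ^ e"
            unfolding tw by (simp only: power_mult_distrib power_mult of_real_power)
          then have "x * t ^ e = of_real (r ^ (4 * e)) * (x * w ^ e)" by (simp only: mult_ac)
          then show ?thesis unfolding we by (simp add: mult.commute)
        qed
        finally have "norm (1 - x * t * t ^ (e - 1)) = \<bar>1 - y * r ^ (4 * e)\<bar>"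
          by (metis norm_of_real of_real_1 of_real_diff)
        moreover have "norm (\<Prod>j\<in>{..<n} - {e - 1}. 1 - x * t * t ^ j) \<le> exp (y / (1 - R))"
        proof (rule norm_prod_one_minus_le)
          show "norm (x * t * t ^ j) \<le> y * R ^ j" for j
            unfolding norm_mult xn using tj[of j] t1 y by (intro mult_mono) auto
        qed (use R y in auto)
        ultimately show ?thesis
          unfolding qpoch_def prod.remove[OF finite_lessThan mem] norm_mult by (simp add: mult_left_mono)
      qed
      then show "\<exists>N. \<forall>n\<ge>N. norm (qpoch (x * t) t n) \<le> \<bar>1 - y * r ^ (4 * e)\<bar> * exp (y / (1 - R))" by blast
    qed
    have "norm A = norm (theta_product b (of_real r * q)) * norm B * norm D"
      using BD by (simp add: TP norm_divide norm_mult)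
    also have "\<dots> \<le> (norm L + 1) * exp (1 / (1 - R)) * (\<bar>1 - y * r ^ (4 * e)\<bar> * exp (y / (1 - R)))"
      using \<epsilon>(2)[OF re mono(3)] by (intro mult_mono B D) auto
    finally show ?thesis using A unfolding K'_def r_def by (simp add: mult_ac)
  qed
  have "((\<lambda>\<mu>. K' * \<bar>1 - y * \<rho> \<mu> ^ (4 * e)\<bar>) \<longlongrightarrow> K' * \<bar>1 - y * \<rho> (real e) ^ (4 * e)\<bar>) (at_right (real e))"
    unfolding \<rho>_def using e0 by (intro tendsto_intros) auto
  moreover have "y * \<rho> (real e) ^ (4 * e) = 1"
  proof -
    have "\<rho> (real e) ^ (4 * e) = exp (real (4 * e) * (- ln y / (4 * real e)))"
      unfolding \<rho>_def exp_of_nat_mult ..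
    also have "real (4 * e) * (- ln y / (4 * real e)) = - ln y" using e0 by simp
    finally show ?thesis using y by (simp add: exp_minus)
  qed
  ultimately have "((\<lambda>\<mu>. K' * \<bar>1 - y * \<rho> \<mu> ^ (4 * e)\<bar>) \<longlongrightarrow> 0) (at_right (real e))" by simp
  moreover have "\<forall>\<^sub>F \<mu> in at_right (real e). K \<le> K' * \<bar>1 - y * \<rho> \<mu> ^ (4 * e)\<bar>"
    by (rule eventually_at_rightI[of _ "real e + 1"]) (auto intro: ineq)
  ultimately have "K \<le> 0" by (intro tendsto_lowerbound[of _ _ "at_right (real e)"]) auto
  then show False by (simp add: K_def)
qed

subsection \<open>The series at a root of unity\<close>

lemma zeta_powi_power_eq_1_iff:
  assumes "k > 0" shows "(zeta k powi h) ^ n = 1 \<longleftrightarrow> int k dvd h * int n"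
proof -
  have "(zeta k powi h) ^ n = exp (of_int (h * int n) * (2 * of_real pi * \<i> / of_nat k))"
    unfolding zeta_def exp_power_int exp_of_nat_mult[symmetric] by (simp add: mult_ac)
  also have "\<dots> = 1 \<longleftrightarrow> (\<exists>m::int. of_int (h * int n) * (2 * pi / real k) = of_int (2 * m) * pi)"
    by (simp add: exp_eq_1 mult_ac)
  also have "\<dots> \<longleftrightarrow> (\<exists>m::int. h * int n = int k * m)"
  proof (intro ex_cong1)
    fix m :: int
    have "of_int (h * int n) * (2 * pi / real k) = of_int (2 * m) * pi
        \<longleftrightarrow> real_of_int (h * int n) = real_of_int (int k * m)"
      using assms by (simp add: field_simps)
    then show "of_int (h * int n) * (2 * pi / real k) = of_int (2 * m) * pi \<longleftrightarrow> h * int n = int k * m"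
      by (simp only: of_int_eq_iff)
  qed
  finally show ?thesis by (simp add: dvd_def)
qed

lemma inj_on_power:
  fixes w :: complex
  assumes "w \<noteq> 0" "\<And>n. 0 < n \<Longrightarrow> n < m \<Longrightarrow> w ^ n \<noteq> 1"
  shows "inj_on (\<lambda>j. w ^ j) {..<m}"
proof (rule linorder_inj_onI)
  fix i j assume ij: "i < j" "i \<in> {..<m}" "j \<in> {..<m}"
  show "w ^ i \<noteq> w ^ j"
  proof
    assume "w ^ i = w ^ j"
    moreover have "w ^ j = w ^ i * w ^ (j - i)" using ij by (simp flip: power_add)
    ultimately have "w ^ (j - i) = 1" using assms(1) by simp
    then show False using assms(2)[of "j - i"] ij less_imp_diff_less[of j m i] by simp
  qed
qed auto

context root_of_unity
begin

text \<open>Splitting off one period turns the sum S into -S/(1 - z^M) +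
  \<open>half_theta z\<close>; the equation is kept cleared of denominators, matching the factor 2 -
  z^M of the final formula.\<close>

lemma half_theta_series:
  assumes nz: "\<And>n. qpoch (z * Q) Q (Suc n) \<noteq> 0"
    and sum: "summable (\<lambda>n. q ^ (n\<^sup>2 + n) / qpoch (z * Q) Q (Suc n))"
  shows "norm (1 - z ^ M) > 1"
    and "(2 - z ^ M) * (\<Sum>n. q ^ (n\<^sup>2 + n) / qpoch (z * Q) Q (Suc n)) = (1 - z ^ M) * half_theta z"
proof -
  define a where "a = (\<lambda>n. q ^ (n\<^sup>2 + n) / qpoch (z * Q) Q (Suc n))"
  have zM: "(z * Q) ^ M = z ^ M" using Q_pow_M[of z 1] by simp
  \<comment> \<open>The denominator of index M - 1 is a product over one full period, which equals 1
    - z^M.\<close>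
  have c: "1 - z ^ M \<noteq> 0" using nz[of "M - 1"] M by (simp add: qpoch_M zM)
  have shift: "a (n + M) = - a n / (1 - z ^ M)" for n
  proof -
    have "Suc (n + M) = M + Suc n" by simp
    then have "qpoch (z * Q) Q (Suc (n + M)) = (1 - z ^ M) * qpoch (z * Q) Q (Suc n)"
      by (simp only: qpoch_add qpoch_M zM QM) simp
    then show ?thesis unfolding a_def q_quad by simp
  qed
  have a0: "a 0 \<noteq> 0" using nz[of 0] by (simp add: a_def)
  have pow: "norm (a (j * M)) = norm (a 0) / norm (1 - z ^ M) ^ j" for j
  proof (induction j)
    case (Suc j)
    have "a (Suc j * M) = a (j * M + M)" by (simp add: add.commute)
    then show ?case using Suc.IH by (simp add: shift norm_divide)
  qed simp
  have "(\<lambda>j. norm (a (j * M))) \<longlonglongrightarrow> 0"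
  proof -
    have "a \<longlonglongrightarrow> 0" using sum unfolding a_def by (rule summable_LIMSEQ_zero)
    then have "(\<lambda>j. a (j * M)) \<longlonglongrightarrow> 0"
      using M LIMSEQ_subseq_LIMSEQ[of a 0 "\<lambda>j. j * M"] by (simp add: comp_def strict_mono_def)
    then show ?thesis by (rule tendsto_norm_zero)
  qed
  then have lim: "(\<lambda>j. norm (a 0) / norm (1 - z ^ M) ^ j) \<longlonglongrightarrow> 0" unfolding pow .
  show "norm (1 - z ^ M) > 1"
  proof (rule ccontr)
    assume le: "\<not> norm (1 - z ^ M) > 1"
    \<comment> \<open>Otherwise the terms at multiples of M never drop below the first one, although
      the terms of a convergent series tend to 0.\<close>
    have "norm (a 0) \<le> norm (a 0) / norm (1 - z ^ M) ^ j" for j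
    proof -
      have "norm (1 - z ^ M) ^ j \<le> 1" "norm (1 - z ^ M) ^ j > 0"
        using le c by (auto intro!: power_le_one)
      then show ?thesis by (simp add: pos_le_divide_eq mult_left_le)
    qed
    then have "norm (a 0) \<le> 0" using lim by (intro LIMSEQ_le_const[OF lim]) auto
    then show False using a0 by simp
  qed
  define S where "S = (\<Sum>n. a n)"
  have "S = (\<Sum>n. a (n + M)) + (\<Sum>n<M. a n)"
    unfolding S_def using sum by (intro suminf_split_initial_segment) (simp add: a_def)
  also have "(\<Sum>n. a (n + M)) = (\<Sum>n. (- 1 / (1 - z ^ M)) * a n)"
    by (simp add: shift)
  also have "\<dots> = (- 1 / (1 - z ^ M)) * S"
    unfolding S_def using sum by (intro suminf_mult) (simp add: a_def)
  also have "(\<Sum>n<M. a n) = half_theta z" by (simp add: half_theta_def a_def)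
  finally have "(1 - z ^ M) * S = (1 - z ^ M) * ((- 1 / (1 - z ^ M)) * S + half_theta z)" by simp
  moreover have "(1 - z ^ M) * (- 1 / (1 - z ^ M)) = -1" using c by simp
  ultimately have "(1 - z ^ M) * S = - S + (1 - z ^ M) * half_theta z"
    by (simp only: distrib_left mult.assoc[symmetric]) simp
  then show "(2 - z ^ M) * (\<Sum>n. q ^ (n\<^sup>2 + n) / qpoch (z * Q) Q (Suc n)) = (1 - z ^ M) * half_theta z"
    unfolding S_def a_def by (simp add: algebra_simps)
qed

text \<open>The second half of the sum is the first half times (1 - b^M) b^(-M) = b^(-M) - 1, so the
  two halves together give the factor b^(-M).\<close>

lemma qpoch_sum_double_period:
  assumes b: "b \<noteq> 0"
  shows "(\<Sum>n<2 * M. qpoch b Q n * (- inverse b * Q) ^ n) = inverse b ^ M * finite_side (inverse b)"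
proof -
  define t where "t = (\<lambda>n. qpoch b Q n * (- inverse b * Q) ^ n)"
  have t: "t n = Q ^ n * (\<Prod>j<n. Q ^ j - inverse b)" for n
  proof (induction n)
    case (Suc n)
    have "t (Suc n) = t n * ((1 - b * Q ^ n) * (- inverse b * Q))"
      by (simp add: t_def qpoch_Suc mult_ac)
    also have "(1 - b * Q ^ n) * (- inverse b * Q) = Q * (Q ^ n - inverse b)"
      using b by (simp add: field_simps)
    finally show ?case using Suc.IH by (simp add: mult_ac)
  qed (simp add: t_def qpoch_def)
  have shift: "t (n + M) = (inverse b ^ M - 1) * t n" for n
  proof -
    have "qpoch b Q (n + M) = (1 - b ^ M) * qpoch b Q n"
      using qpoch_add[of b Q M n] by (simp add: qpoch_M QM add.commute)
    moreover have "(- inverse b * Q) ^ M = inverse b ^ M"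
      using M by (simp add: power_mult_distrib QM)
    moreover have "(1 - b ^ M) * inverse b ^ M = inverse b ^ M - 1"
    proof -
      have "b ^ M * inverse b ^ M = 1" using b by (simp add: power_inverse)
      then show ?thesis by (simp only: left_diff_distrib mult_1)
    qed
    ultimately show ?thesis
      unfolding t_def power_add by (simp add: mult_ac)
  qed
  have "(\<Sum>n<2 * M. t n) = (\<Sum>n<M. t n) + (\<Sum>n<M. t (n + M))"
    using sum.atLeastLessThan_concat[of 0 M "2 * M" t] sum.shift_bounds_nat_ivl[of t 0 M M]
    by (simp add: lessThan_atLeast0 mult_2)
  also have "\<dots> = inverse b ^ M * (\<Sum>n<M. t n)"
    unfolding shift sum_distrib_left[symmetric] by (simp add: algebra_simps)
  also have "(\<Sum>n<M. t n) = finite_side (inverse b)" by (simp add: finite_side_def t)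
  finally show ?thesis by (simp add: t_def)
qed

end

section \<open>The identity in terms of h, k and b\<close>

theorem theorem1p1:
  fixes k :: nat and h :: int and b q s L :: complex
  assumes "k > 0" and "k mod 4 = 0" and "gcd h (int k) = 1"
    and "q = zeta k powi h"
    and "b \<noteq> 0"
    and "s = 1 \<or> s = -1"
    and "\<forall>n. series_denom s b q n \<noteq> 0"
    and "summable (\<lambda>n. q ^ (n\<^sup>2 + n) / series_denom s b q n)"
    and "((\<lambda>r. theta_product b (of_real r * q)) \<longlongrightarrow> L) (at_left (1::real))"
  shows "(\<Sum>n<k. qpoch b (q\<^sup>2) n * (- inverse b * q\<^sup>2) ^ n)
    = p_factor h k b * (-1) powi h * (s * b) * (1 - b powi (- int (k div 2)) - (-1) powi h)
      * ((\<Sum>n. q ^ (n\<^sup>2 + n) / series_denom s b q n) - L)"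
proof -
  \<comment> \<open>N is the order of q^4, the base of the products, while M = 2N is the order of
    q^2.\<close>
  obtain N where N: "k = 4 * N" using assms(2) by (metis mod_0_imp_dvd dvd_def)
  have N0: "N > 0" using assms(1) N by simp
  define M where "M = 2 * N"
  have q1: "q ^ n = 1 \<longleftrightarrow> k dvd n" for n
  proof -
    have "coprime (int k) h" using assms(3) by (simp add: coprime_iff_gcd_eq_1 gcd.commute)
    then have "int k dvd h * int n \<longleftrightarrow> int k dvd int n" by (simp add: coprime_dvd_mult_right_iff)
    then show ?thesis unfolding assms(4) zeta_powi_power_eq_1_iff[OF assms(1)] by simp
  qed
  have q0: "q \<noteq> 0" using q1[of k] assms(1) by (metis dvd_refl power_0_left not_gr0 zero_neq_one)
  have "odd h"
  proof
    assume "even h"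
    then have "2 dvd gcd h (int k)" using N by simp
    then show False using assms(3) by simp
  qed
  then have h: "(-1 :: complex) powi h = -1" by (simp add: power_int_minus_one_minus power_int_minus_left)
  interpret root_of_unity M q "q\<^sup>2"
  proof
    show "even M" "M > 0" using N0 by (simp_all add: M_def)
    have "(q ^ M)\<^sup>2 = 1" using q1[of k] by (simp add: M_def N mult_ac flip: power_mult)
    moreover have "q ^ M \<noteq> 1" using N0 unfolding q1 by (auto simp: M_def N dest: dvd_imp_le)
    ultimately show "q ^ M = -1" by (simp add: power2_eq_1_iff)
    show "inj_on (\<lambda>j. (q\<^sup>2) ^ j) {..<M}"
    proof (rule inj_on_power)
      fix n assume "0 < n" "n < M"
      then show "(q\<^sup>2) ^ n \<noteq> 1"
        unfolding power_mult[symmetric] q1 by (auto simp: M_def N dest: dvd_imp_le)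
    qed (use q0 in simp)
  qed simp
  have inj4: "inj_on (\<lambda>j. (q ^ 4) ^ j) {..<N}"
  proof (rule inj_on_power)
    fix n assume "0 < n" "n < N"
    then show "(q ^ 4) ^ n \<noteq> 1"
      unfolding power_mult[symmetric] q1 by (auto simp: N dest: dvd_imp_le)
  qed (use q0 in simp)
  have q2N: "(q\<^sup>2) ^ N = -1" using qM by (simp add: M_def power_mult)
  have q4N: "(q ^ 4) ^ N = 1" using q1[of k] by (simp add: N power_mult)
  \<comment> \<open>Since M is even, c is the same for both signs s. It also equals (b^(-2))^N, so
    one number governs both the series and the theta product.\<close>
  define z c where "z = s * inverse b" and "c = inverse b ^ M"
  have zM: "z ^ M = c" using assms(6) M by (auto simp: z_def c_def power_mult_distrib)
  have sz: "s * z = inverse b" using assms(6) by (auto simp: z_def)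
  have z0: "z \<noteq> 0" using assms(5,6) by (auto simp: z_def)
  have denom: "series_denom s b q n = qpoch (z * q\<^sup>2) (q\<^sup>2) (Suc n)" for n
    by (simp add: series_denom_def z_def)
  have ser: "norm (1 - c) > 1"
    "(2 - c) * (\<Sum>n. q ^ (n\<^sup>2 + n) / series_denom s b q n) = (1 - c) * half_theta z"
    using half_theta_series[of z] assms(7,8) unfolding denom zM by auto
  then have c12: "c \<noteq> 1" "c \<noteq> 2" by auto
  have x: "(b powi (-2)) ^ N = c"
    by (simp add: c_def M_def power_mult power_int_minus power_inverse)
  have L: "L = 0"
  proof (cases "c \<in> slit_plane")
    case True
    have "((\<lambda>r. theta_product b (of_real r * q)) \<longlongrightarrow> 0) (at_left 1)"
      using True ser(1) by (intro theta_product_tendsto_0[OF N0 inj4 q2N]) (auto simp: x)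
    from tendsto_unique[OF _ assms(9) this] show ?thesis by (simp add: trivial_limit_at_left_real)
  next
    case False
    \<comment> \<open>On the cut c is real and at least 1, and c = 1 is excluded, so poles
      accumulate and the assumed limit cannot exist.\<close>
    then have "c = of_real (Re c)" "Re c \<ge> 1" by (auto simp: slit_plane_iff complex_eq_iff)
    then have "(b powi (-2)) ^ N = of_real (Re c)" "Re c > 1" using c12 x by (auto simp: order.order_iff_strict complex_eq_iff)
    from theta_product_not_convergent[OF N0 inj4 q4N this] assms(9) show ?thesis by blast
  qed
  have k2: "k div 2 = M" "k = 2 * M" by (simp_all add: N M_def)
  have bM: "b powi (- int M) = c" by (simp add: c_def power_int_minus power_inverse)
  have bc: "b ^ M * c = 1" using assms(5) by (simp add: c_def power_inverse)
  have "b * b ^ (M - 1) = b ^ M" using M by (metis power_minus_mult mult.commute)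
  \<comment> \<open>As b^M c = 1, the first factor 1 + c - b^M c reduces to c. The last factor is
    also c because h is odd, and it cancels b^M.\<close>
  then have p: "p_factor h k b * b = c"
  proof -
    assume e: "b * b ^ (M - 1) = b ^ M"
    have "(- inverse b) ^ M = c" using M by (simp add: c_def)
    then have "p_factor h k b * b = (1 + c * (1 - b ^ M)) * (b * b ^ (M - 1)) * (1 + -1 * (1 - c))"
      by (simp add: p_factor_def k2 h bM)
    also have "\<dots> = (1 + c - b ^ M * c) * (b ^ M * c)" unfolding e by (simp add: algebra_simps)
    finally show ?thesis by (simp add: bc)
  qed
  have "(\<Sum>n<k. qpoch b (q\<^sup>2) n * (- inverse b * q\<^sup>2) ^ n) = c * finite_side (s * z)"
    unfolding k2(2) qpoch_sum_double_period[OF assms(5)] sz c_def ..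
  also have "finite_side (s * z) = - s * ((1 - c) * half_theta z)"
    using half_theta_eq_finite_side[of z s] c12 z0 assms(6) by (simp add: zM mult.assoc)
  also have "c * \<dots> = (p_factor h k b * b) * (-1) * s * (2 - c) * (\<Sum>n. q ^ (n\<^sup>2 + n) / series_denom s b q n)"
    unfolding p ser(2)[symmetric] by (simp add: mult_ac)
  finally show ?thesis
    unfolding k2(1) bM h L by (simp add: mult_ac)
qed

end
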